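(* Let $f:\mathbb{C}\to\mathbb{C}$ be a transcendental entire function such that its Julia set $J(f)$ is locally connected. Then $J(f)$ is a spider's web; that is, $J(f)$ is connected and there exists a sequence $(G_k)_{k\in\mathbb{N}}$ of bounded, simply connected domains in $\mathbb{C}$ such that $G_k\subset G_{k+1}$ and $\partial G_k\subset J(f)$ for each $k\in\mathbb{N}$, and $\bigcup_{k\in\mathbb{N}}G_k=\mathbb{C}$.
   Context: For a transcendental entire function $f$, $f^n$ denotes the $n$th iterate. The Fatou set $F(f)$ is the set of $z\in\mathbb{C}$ such that $\{f^n:n\in\mathbb{N}\}$ is a normal family in some neighbourhood of $z$; the Julia set is $J(f)=\mathbb{C}\setminus F(f)$. A Hausdorff space $X$ is locally connected at $x\in X$ if $x$ has arbitrarily small connected (not necessarily open) neighbourhoods in $X$; $X$ is locally connected if this holds at every $x\in X$. $J(f)$ carries the subspace topology from $\mathbb{C}$. *)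

theory Defs
  imports "HOL-Complex_Analysis.Complex_Analysis"
    "HOL-Computational_Algebra.Polynomial"
begin

definition transcendental_entire :: "(complex \<Rightarrow> complex) \<Rightarrow> bool" where
  "transcendental_entire f \<longleftrightarrow> f holomorphic_on UNIV \<and> \<not> (\<exists>p. f = poly p)"

(* Normality as used in complex dynamics: locally uniform divergence to infinity counts as
   convergence (to the constant infinity), i.e. convergence is with respect to the spherical
   metric. For a domain U and functions holomorphic on U, a spherical limit is either finite
   everywhere or identically infinite, which gives the two alternatives below. A finite limit g
   is then automatically holomorphic on U. *)
definition normal_family_on :: "complex set \<Rightarrow> (complex \<Rightarrow> complex) set \<Rightarrow> bool" where
  "normal_family_on U \<F> \<longleftrightarrow>
     (\<forall>h :: nat \<Rightarrow> complex \<Rightarrow> complex. range h \<subseteq> \<F> \<longrightarrow>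
        (\<exists>r :: nat \<Rightarrow> nat. strict_mono r \<and>
           ((\<exists>g. \<forall>K. compact K \<and> K \<subseteq> U \<longrightarrow> uniform_limit K (h \<circ> r) g sequentially) \<or>
            (\<forall>K. compact K \<and> K \<subseteq> U \<longrightarrow>
               (\<forall>B. \<forall>\<^sub>F n in sequentially. \<forall>z\<in>K. B \<le> norm (h (r n) z))))))"

(* Neighbourhoods may be taken connected, since normality passes to smaller open sets. *)
definition fatou_set :: "(complex \<Rightarrow> complex) \<Rightarrow> complex set" where
  "fatou_set f =
     {z. \<exists>U. open U \<and> connected U \<and> z \<in> U \<and> normal_family_on U (range (\<lambda>n. f ^^ n))}"

definition julia_set :: "(complex \<Rightarrow> complex) \<Rightarrow> complex set" where
  "julia_set f = - fatou_set f"

definition spiders_web :: "complex set \<Rightarrow> bool" where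
  "spiders_web E \<longleftrightarrow>
     connected E \<and>
     (\<exists>G :: nat \<Rightarrow> complex set.
        (\<forall>k. open (G k) \<and> connected (G k) \<and> G k \<noteq> {} \<and> bounded (G k) \<and> simply_connected (G k) \<and>
             G k \<subseteq> G (Suc k) \<and> frontier (G k) \<subseteq> E) \<and>
        (\<Union>k. G k) = UNIV)"

end

theory Submission
  imports Defs
begin

text \<open>
  Local connectedness at one point of the Julia set \<open>J\<close>, blown up by the iterates of \<open>f\<close>, shows that
  every bounded part of \<open>J\<close> lies in a continuum contained in \<open>J\<close>; in particular \<open>J\<close> is connected.
  Local connectedness at all points implies that only finitely many Fatou components
  cross a given annulus, since three crossing components near an accumulation point would draw
  \<open>K\<^sub>3\<^sub>,\<^sub>3\<close> in the plane.

  It remains to exclude an unbounded Fatou component \<open>U\<close>. A boundary point of \<open>U\<close> that is accessible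
  along a segment has, under some iterate \<open>g\<close>, arbitrarily many preimages in a fixed disc about a point
  of \<open>J\<close>. They are accessible from unbounded preimage components, of which only finitely many meet
  the disc, so two preimages \<open>x \<noteq> y\<close> are accessible from the same component \<open>W\<close>. A cross-cut of \<open>W\<close>
  from \<open>x\<close> to \<open>y\<close> together with a continuum in \<open>J\<close> joining them encloses a bounded open set \<open>Q\<close>; but
  the image of the cross-cut doubles back along the segment, so the boundary of \<open>g(Q)\<close> does not separate
  some point of \<open>g(Q)\<close> from infinity.

  Hence, for each disc, the Fatou components meeting it are uniformly bounded, and a sufficiently large
  continuum in \<open>J\<close>, together with its bounded complementary components, contains the disc.
\<close>

section \<open>Montel and Picard theorems\<close>

text \<open>The Julia set is unbounded, so local connectedness gives no uniform control far out.
  Everything is therefore pulled back into one fixed disc, where compactness is available. This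
  calls for blow-up in a strong form, in which a single iterate serves several points at once: late
  images of one small connected set must share a point, and the pigeonhole argument needs more
  preimages of an accessible boundary point than there are crossing components. Targets of the
  blow-up must avoid the one value that \<open>f\<close> may take only finitely often (Picard). To
  prove the strong form, both kinds of limits in Montel's theorem must be excluded: points of
  bounded orbit exclude the limit infinity, and growth of the iterates on large circles excludes
  finite limits. That growth comes from whole circles in the image of a disc. Preimage components of
  an unbounded component are unbounded, since an iterate is proper on a bounded component; so they
  are crossing components, and finiteness applies to them.\<close>

definition spherically_convergent_on :: "complex set \<Rightarrow> (nat \<Rightarrow> complex \<Rightarrow> complex) \<Rightarrow> bool" where
  "spherically_convergent_on U h \<longleftrightarrow>
     (\<exists>g. \<forall>K. compact K \<and> K \<subseteq> U \<longrightarrow> uniform_limit K h g sequentially) \<or>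
     (\<forall>K. compact K \<and> K \<subseteq> U \<longrightarrow> (\<forall>B. \<forall>\<^sub>F n in sequentially. \<forall>z\<in>K. B \<le> norm (h n z)))"

lemma normal_family_on_iff:
  "normal_family_on U \<F> \<longleftrightarrow>
     (\<forall>h :: nat \<Rightarrow> complex \<Rightarrow> complex. range h \<subseteq> \<F> \<longrightarrow>
        (\<exists>r :: nat \<Rightarrow> nat. strict_mono r \<and> spherically_convergent_on U (h \<circ> r)))"
  unfolding normal_family_on_def spherically_convergent_on_def comp_apply by (rule refl)

text \<open>Schottky's bound (\<open>GPicard3\<close>) spreads the bound at the single point
  \<open>w\<close> over compact sets; Montel's theorem for locally bounded families does the
  rest.\<close>

lemma Montel_bounded_subsequence:
  fixes k :: "nat \<Rightarrow> complex \<Rightarrow> complex"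
  assumes S: "open S" "connected S" "w \<in> S"
    and hol: "\<And>n. k n holomorphic_on S"
    and omit: "\<And>n z. z \<in> S \<Longrightarrow> k n z \<noteq> 0 \<and> k n z \<noteq> 1"
    and le1: "\<And>n. norm (k n w) \<le> 1"
  obtains g r where "g holomorphic_on S" "strict_mono (r :: nat \<Rightarrow> nat)"
    "\<And>K. \<lbrakk>compact K; K \<subseteq> S\<rbrakk> \<Longrightarrow> uniform_limit K (k \<circ> r) g sequentially"
proof (rule Montel [of S "range k" k])
  fix K assume K: "compact K" "K \<subseteq> S"
  obtain B where "\<And>h z. \<lbrakk>h \<in> range k; z \<in> K\<rbrakk> \<Longrightarrow> norm(h z) \<le> B"
  proof (rule GPicard3 [OF S, where K = K and Y = "range k" and X = "range k"])
    show "\<And>h. h \<in> range k \<Longrightarrow> cmod (h w) \<le> 1" using le1 by auto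
    show "\<And>h. h \<in> range k \<Longrightarrow> h holomorphic_on S" using hol by auto
    show "\<And>h z. h \<in> range k \<Longrightarrow> z \<in> S \<Longrightarrow> h z \<noteq> 0 \<and> h z \<noteq> 1" using omit by auto
  qed (use K in auto)
  then show "\<exists>B. \<forall>h\<in>range k. \<forall>z\<in>K. cmod (h z) \<le> B" by blast
next
  fix g r
  assume "g holomorphic_on S" "strict_mono (r :: nat \<Rightarrow> nat)"
    "\<And>K. compact K \<Longrightarrow> K \<subseteq> S \<Longrightarrow> uniform_limit K (k \<circ> r) g sequentially"
  then show thesis using that by blast
qed (use S hol in auto)

lemma spherically_convergent_on_affine:
  assumes c: "c \<noteq> 0" and k: "spherically_convergent_on S k"
  shows "spherically_convergent_on S (\<lambda>n z. a + c * k n z)"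
  using k unfolding spherically_convergent_on_def
proof (elim disjE exE, goal_cases)
  case (1 g)
  have "uniform_limit K (\<lambda>n z. a + c * k n z) (\<lambda>z. a + c * g z) sequentially"
    if "compact K \<and> K \<subseteq> S" for K
  proof -
    have "uniform_limit K (\<lambda>n z. c * k n z) (\<lambda>z. c * g z) sequentially"
      by (rule bounded_linear.uniform_limit [OF bounded_linear_mult_right]) (use 1 that in blast)
    then show ?thesis
      by (intro uniform_limit_add uniform_limit_const)
  qed
  then show ?case by blast
next
  case 2
  have "\<forall>\<^sub>F n in sequentially. \<forall>z\<in>K. B \<le> cmod (a + c * k n z)" if "compact K \<and> K \<subseteq> S" for K B
  proof -
    have "\<forall>\<^sub>F n in sequentially. \<forall>z\<in>K. (\<bar>B\<bar> + cmod a) / cmod c \<le> cmod (k n z)"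
      using 2 that by blast
    then show ?thesis
    proof eventually_elim
      case (elim n)
      show ?case
      proof
        fix z assume "z \<in> K"
        then have "\<bar>B\<bar> + cmod a \<le> cmod c * cmod (k n z)"
          using elim c by (simp add: divide_simps mult.commute)
        also have "\<dots> = cmod ((a + c * k n z) - a)"
          by (simp add: norm_mult)
        also have "\<dots> \<le> cmod (a + c * k n z) + cmod a"
          by (rule norm_triangle_ineq4)
        finally show "B \<le> cmod (a + c * k n z)" by linarith
      qed
    qed
  qed
  then show ?case by blast
qed

text \<open>Along a subsequence either \<open>k n\<close> or its reciprocal is bounded by 1 at
  \<open>w\<close>, and both omit 0 and 1. By Hurwitz's theorem a limit of the reciprocals is
  identically 0, which means the limit infinity for \<open>k\<close>, or it has no zeros and can be
  inverted again.\<close>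

lemma Montel_omits_01:
  fixes k :: "nat \<Rightarrow> complex \<Rightarrow> complex"
  assumes S: "open S" "connected S"
    and hol: "\<And>n. k n holomorphic_on S"
    and omit: "\<And>n z. z \<in> S \<Longrightarrow> k n z \<noteq> 0 \<and> k n z \<noteq> 1"
  obtains r where "strict_mono (r :: nat \<Rightarrow> nat)" "spherically_convergent_on S (k \<circ> r)"
proof (cases "S = {}")
  case True
  then show thesis
    by (intro that [of id]) (auto simp: spherically_convergent_on_def strict_mono_id)
next
  case False
  then obtain w where w: "w \<in> S" by blast
  consider "infinite {n. norm(k n w) \<le> 1}" | "infinite {n. 1 \<le> norm(k n w)}"
    by (metis (mono_tags, lifting) infinite_nat_iff_unbounded_le le_cases mem_Collect_eq)
  then show thesis
  proof cases
    case 1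
    then obtain r :: "nat \<Rightarrow> nat" where r: "strict_mono r" "\<And>n. r n \<in> {n. norm(k n w) \<le> 1}"
      using infinite_enumerate by blast
    obtain g q where gq: "g holomorphic_on S" "strict_mono (q :: nat \<Rightarrow> nat)"
      "\<And>K. \<lbrakk>compact K; K \<subseteq> S\<rbrakk> \<Longrightarrow> uniform_limit K ((k \<circ> r) \<circ> q) g sequentially"
      by (rule Montel_bounded_subsequence [OF S w, of "k \<circ> r"]) (use hol omit r in auto)
    show thesis
    proof
      show "strict_mono (r \<circ> q)" using r gq by (simp add: strict_mono_o)
      show "spherically_convergent_on S (k \<circ> (r \<circ> q))"
        using gq(3) unfolding spherically_convergent_on_def o_assoc by blast
    qed
  next
    case 2
    then obtain r :: "nat \<Rightarrow> nat" where r: "strict_mono r" "\<And>n. r n \<in> {n. 1 \<le> norm(k n w)}"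
      using infinite_enumerate by blast
    let ?i = "\<lambda>n z. inverse (k (r n) z)"
    have holi: "?i n holomorphic_on S" for n
      using omit by (intro holomorphic_intros hol) auto
    obtain g q where g: "g holomorphic_on S" and q: "strict_mono (q :: nat \<Rightarrow> nat)"
      and ul: "\<And>K. \<lbrakk>compact K; K \<subseteq> S\<rbrakk> \<Longrightarrow> uniform_limit K (?i \<circ> q) g sequentially"
    proof (rule Montel_bounded_subsequence [OF S w, of ?i])
      show "inverse (k (r n) z) \<noteq> 0 \<and> inverse (k (r n) z) \<noteq> 1" if "z \<in> S" for n z
        using omit [OF that, of "r n"] by (simp add: inverse_eq_1_iff)
      show "cmod (inverse (k (r n) w)) \<le> 1" for n
        using r(2) [of n] by (simp add: norm_inverse inverse_le_1_iff)
    qed (use holi in blast)+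
    have sm: "strict_mono (r \<circ> q)" using r q by (simp add: strict_mono_o)
    have "spherically_convergent_on S (k \<circ> (r \<circ> q))"
    proof (cases "\<forall>z\<in>S. g z = 0")
      case True
      have "\<forall>\<^sub>F n in sequentially. \<forall>z\<in>K. B \<le> cmod (k (r (q n)) z)" if "compact K \<and> K \<subseteq> S" for K B
      proof -
        have "\<forall>\<^sub>F n in sequentially. \<forall>z\<in>K. dist ((?i \<circ> q) n z) (g z) < inverse (\<bar>B\<bar> + 1)"
          using ul [of K] that unfolding o_def by (intro uniform_limitD) auto
        then show ?thesis
        proof eventually_elim
          case (elim n)
          show ?case
          proof
            fix z assume z: "z \<in> K"
            have "g z = 0" using True z that by blast
            with elim z have "inverse (cmod (k (r (q n)) z)) < inverse (\<bar>B\<bar> + 1)"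
              by (force simp: dist_norm norm_inverse)
            moreover have "0 < cmod (k (r (q n)) z)" using omit z that by auto
            ultimately have "\<bar>B\<bar> + 1 < cmod (k (r (q n)) z)"
              by (simp add: inverse_less_iff_less)
            then show "B \<le> cmod (k (r (q n)) z)" by linarith
          qed
        qed
      qed
      then show ?thesis unfolding spherically_convergent_on_def o_def by blast
    next
      case False
      have nz: "g z \<noteq> 0" if "z \<in> S" for z
      proof (cases "g constant_on S")
        case True
        then show ?thesis using False that unfolding constant_on_def by metis
      next
        case False
        then show ?thesis
          by (rule_tac Hurwitz_no_zeros [OF S, of "?i \<circ> q" g]) (use holi g ul omit that in auto)
      qed
      have "uniform_limit K (k \<circ> (r \<circ> q)) (\<lambda>z. inverse (g z)) sequentially" if K: "compact K \<and> K \<subseteq> S" for K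
      proof (cases "K = {}")
        case False
        have "continuous_on K (\<lambda>z. cmod (g z))"
          using g K holomorphic_on_imp_continuous_on holomorphic_on_subset by (blast intro: continuous_intros)
        then obtain u where u: "u \<in> K" "\<And>z. z \<in> K \<Longrightarrow> cmod (g u) \<le> cmod (g z)"
          using continuous_attains_inf [of K "\<lambda>z. cmod (g z)"] K False by blast
        have "uniform_limit K (\<lambda>n z. inverse ((?i \<circ> q) n z)) (inverse \<circ> g) sequentially"
          by (rule uniform_lim_inverse [of _ _ _ _ "cmod (g u)"]) (use ul [of K] K u nz in \<open>auto simp: o_def\<close>)
        then show ?thesis by (simp add: o_def)
      qed auto
      then show ?thesis unfolding spherically_convergent_on_def by blast
    qed
    with sm show thesis using that by blast
  qed
qed

theorem Montel_omits_two:
  fixes h :: "nat \<Rightarrow> complex \<Rightarrow> complex"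
  assumes S: "open S" "connected S"
    and hol: "\<And>n. h n holomorphic_on S" and "a \<noteq> b"
    and omit: "\<And>n z. z \<in> S \<Longrightarrow> h n z \<noteq> a \<and> h n z \<noteq> b"
  obtains r where "strict_mono (r :: nat \<Rightarrow> nat)" "spherically_convergent_on S (h \<circ> r)"
proof -
  let ?k = "\<lambda>n z. (h n z - a) / (b - a)"
  obtain r where r: "strict_mono (r :: nat \<Rightarrow> nat)" "spherically_convergent_on S (?k \<circ> r)"
  proof (rule Montel_omits_01 [OF S, of ?k])
    show "?k n holomorphic_on S" for n
      using \<open>a \<noteq> b\<close> by (intro holomorphic_intros hol) auto
    show "(h n z - a) / (b - a) \<noteq> 0 \<and> (h n z - a) / (b - a) \<noteq> 1" if "z \<in> S" for n z
      using omit [OF that, of n] \<open>a \<noteq> b\<close> by (auto simp: field_simps)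
  qed blast
  have "spherically_convergent_on S (\<lambda>n z. a + (b - a) * (?k \<circ> r) n z)"
    using \<open>a \<noteq> b\<close> by (intro spherically_convergent_on_affine r) auto
  moreover have "(\<lambda>n z. a + (b - a) * (?k \<circ> r) n z) = h \<circ> r"
    using \<open>a \<noteq> b\<close> by (auto simp: fun_eq_iff)
  ultimately show thesis using r that by simp
qed

text \<open>Great Picard for \<open>f \<circ> inverse\<close> at 0: a removable singularity would
  make \<open>f\<close> constant by Liouville's theorem, a pole would make it a polynomial.\<close>

theorem transcendental_Picard:
  assumes f: "transcendental_entire f"
  obtains a where "\<And>w. w \<noteq> a \<Longrightarrow> infinite {z. f z = w}"
proof -
  have holf: "f holomorphic_on UNIV" and np: "\<And>p. f \<noteq> poly p"
    using f by (auto simp: transcendental_entire_def)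
  have lim: "\<not> ((inverse \<circ> f) \<longlongrightarrow> l) at_infinity" for l
  proof
    assume "((inverse \<circ> f) \<longlongrightarrow> l) at_infinity"
    then obtain a n where "\<And>z. f z = (\<Sum>i\<le>n. a i * z ^ i)"
      using pole_at_infinity [OF holf] by metis
    then have "f = poly (\<Sum>i\<le>n. monom (a i) i)"
      by (auto simp: poly_sum poly_monom)
    with np show False by blast
  qed
  obtain a where a: "\<And>w. w \<noteq> a \<Longrightarrow> infinite {x. x \<in> UNIV - {0} \<and> (f \<circ> inverse) x = w}"
  proof (rule great_Picard_infinite [of UNIV 0 "f \<circ> inverse"])
    show "f \<circ> inverse holomorphic_on UNIV - {0}"
      by (rule holomorphic_on_compose holomorphic_intros holomorphic_on_subset [OF holf] | force)+
    show "\<not> ((f \<circ> inverse) \<midarrow>0\<rightarrow> l)" for l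
    proof
      assume "(f \<circ> inverse) \<midarrow>0\<rightarrow> l"
      then have "(f \<longlongrightarrow> l) at_infinity" by (simp add: lim_at_infinity_0)
      then have "f = poly [:l:]"
        using Liouville_weak [OF holf] by (auto simp: fun_eq_iff)
      with np show False by blast
    qed
    show "\<not> ((inverse \<circ> (f \<circ> inverse)) \<midarrow>0\<rightarrow> l)" for l
      using lim [of l] by (simp add: lim_at_infinity_0 o_assoc)
  qed auto
  have "infinite {z. f z = w}" if "w \<noteq> a" for w
  proof
    assume "finite {z. f z = w}"
    then have "finite (inverse ` {z. f z = w})" by simp
    moreover have "{x. x \<in> UNIV - {0} \<and> (f \<circ> inverse) x = w} \<subseteq> inverse ` {z. f z = w}"
      by (auto simp: image_iff) (metis inverse_inverse_eq)
    ultimately show False using a [OF that] finite_subset by blast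
  qed
  then show thesis using that by blast
qed

section \<open>Growth of transcendental entire functions\<close>

lemma max_modulus_sphere:
  assumes g: "g holomorphic_on UNIV" and w: "norm w \<le> r" and "0 < r"
  obtains z where "norm z = r" "norm (g w) \<le> norm (g z)"
proof -
  have cont: "continuous_on A g" for A
    using g holomorphic_on_imp_continuous_on holomorphic_on_subset by blast
  have "sphere (0::complex) r \<noteq> {}" using \<open>0 < r\<close> by simp
  then obtain u where u: "u \<in> sphere 0 r" "\<And>z. z \<in> sphere 0 r \<Longrightarrow> norm (g z) \<le> norm (g u)"
    using continuous_attains_sup [of "sphere 0 r" "\<lambda>z. norm (g z)"] cont
    by (metis compact_sphere continuous_on_norm)
  have "norm (g w) \<le> norm (g u)"
    by (rule maximum_modulus_frontier [of g "cball 0 r"])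
       (use g w u cont \<open>0 < r\<close> holomorphic_on_subset in \<open>auto simp: frontier_cball\<close>)
  with u show thesis by (intro that [of u]) auto
qed

locale transcendental_map =
  fixes f :: "complex \<Rightarrow> complex"
  assumes transcendental: "transcendental_entire f"
begin

lemma holo: "f holomorphic_on S"
  using transcendental holomorphic_on_subset unfolding transcendental_entire_def by blast

lemma not_poly: "f \<noteq> poly p"
  using transcendental unfolding transcendental_entire_def by blast

lemma holo_iter: "(f ^^ n) holomorphic_on S"
proof -
  have "(f ^^ n) holomorphic_on UNIV"
  proof (induction n)
    case (Suc n)
    then show ?case using holomorphic_on_compose [OF Suc holo] by (simp add: o_def)
  qed (simp add: id_def holomorphic_on_ident)
  then show ?thesis using holomorphic_on_subset by blast
qed

lemma cont_iter: "continuous_on S (f ^^ n)"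
  using holo_iter holomorphic_on_imp_continuous_on by blast

lemma not_constant_on: 
  assumes "open S" "S \<noteq> {}"
  shows "\<not> f constant_on S"
proof
  assume "f constant_on S"
  then obtain c where c: "\<And>z. z \<in> S \<Longrightarrow> f z = c" unfolding constant_on_def by blast
  obtain z where z: "z \<in> S" using assms by blast
  have "f w - c = 0" for w
    by (rule analytic_continuation [of "\<lambda>z. f z - c" UNIV S z])
       (use c z assms holo in \<open>auto intro!: holomorphic_intros interior_limit_point simp: interior_open\<close>)
  then have "f = poly [:c:]" by (auto simp: fun_eq_iff)
  then show False using not_poly by blast
qed

lemma open_image: 
  assumes "open S" shows "open (f ` S)"
proof (cases "S = {}")
  case False
  show ?thesis
    by (rule open_mapping_thm [of f UNIV]) (use assms holo not_constant_on [of UNIV] in auto)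
qed auto

lemma open_image_iter: 
  assumes "open S" shows "open ((f ^^ n) ` S)"
proof (induction n)
  case (Suc n)
  then show ?case using open_image [OF Suc] by (simp add: image_image)
qed (use assms in auto)

text \<open>The difference quotient of \<open>f\<close> at 0 is entire and unbounded, since
  \<open>f\<close> is not affine; the maximum principle carries one large value of it to every
  larger circle.\<close>

lemma growth:
  obtains r0 where "r0 > 0" "\<And>r. r \<ge> r0 \<Longrightarrow> \<exists>z. norm z = r \<and> norm (f z) \<ge> K * r"
proof -
  define h where "h = (\<lambda>z. if z = 0 then deriv f 0 else (f z - f 0) / (z - 0))"
  have h: "h holomorphic_on UNIV"
    unfolding h_def by (rule pole_lemma_open [OF holo]) auto
  have fh: "f z = f 0 + z * h z" for z
    by (auto simp: h_def)
  have "\<not> bounded (range h)"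
  proof
    assume "bounded (range h)"
    then have "h constant_on UNIV" using Liouville_theorem [OF h] by blast
    then obtain c where "\<And>z. h z = c" unfolding constant_on_def by blast
    then have "f z = poly [:f 0, c:] z" for z using fh [of z] by simp
    then have "f = poly [:f 0, c:]" by blast
    then show False using not_poly by blast
  qed
  then have "\<not> (\<forall>z. norm (h z) \<le> \<bar>K\<bar> + 1)"
    unfolding bounded_iff by blast
  then obtain z0 where z0: "norm (h z0) > \<bar>K\<bar> + 1"
    by (meson not_le)
  \<comment> \<open>The summand 1 in \<open>\<bar>K\<bar> + 1\<close> pays for the constant term, as
    \<open>norm (f 0) \<le> r\<close>.\<close>
  let ?r = "max 1 (max (norm z0) (norm (f 0)))"
  show thesis
  proof
    fix r assume r: "r \<ge> ?r"
    then have "norm z0 \<le> r" "0 < r" by auto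
    then obtain z where z: "norm z = r" "norm (h z0) \<le> norm (h z)"
      using max_modulus_sphere [OF h] by metis
    have "K * r + r \<le> (\<bar>K\<bar> + 1) * r"
      using r by (simp add: algebra_simps mult_right_mono abs_ge_self)
    also have "\<dots> \<le> norm (h z) * r"
      using z z0 r by (intro mult_right_mono) auto
    also have "\<dots> = norm (f z - f 0)"
      using fh [of z] z by (simp add: norm_mult)
    also have "\<dots> \<le> norm (f z) + norm (f 0)" by (rule norm_triangle_ineq4)
    finally show "\<exists>z. norm z = r \<and> norm (f z) \<ge> K * r"
      using z r by (intro exI [of _ z]) auto
  qed auto
qed

text \<open>Bohr's theorem by way of Schottky's: if circles of radius \<open>2r\<close> and \<open>4r\<close> both contained an omitted value,
  then \<open>f\<close> would grow at most linearly.\<close>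

lemma circle_in_image:
  obtains r0 where "r0 > 0" "\<And>r. r \<ge> r0 \<Longrightarrow> \<exists>s\<ge>2*r. sphere 0 s \<subseteq> f ` cball 0 r"
proof -
  \<comment> \<open>Schottky's bound on the disc of radius 1/2 for a function of modulus at most 2
    at the origin.\<close>
  define C where "C = exp(pi * exp(pi * (2 + 2 * 2 + 12 * (1/2) / (1 - 1/2))))"
  have "C > 0" by (simp add: C_def)
  \<comment> \<open>On the circle of radius \<open>r/2\<close> this yields a modulus of at least
    \<open>(3 + 6 * C) * r\<close>, whereas Schottky's theorem will allow only
    \<open>(2 + 6 * C) * r\<close>.\<close>
  obtain r1 where r1: "r1 > 0" "\<And>r. r \<ge> r1 \<Longrightarrow> \<exists>z. norm z = r \<and> norm (f z) \<ge> (2 * (3 + 6 * C)) * r"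
    using growth by blast
  show thesis
  proof
    show "max (2*r1) (norm (f 0) + 1) > 0" using r1 by auto
    fix r assume r: "r \<ge> max (2*r1) (norm (f 0) + 1)"
    then have "r > 0" using r1 by auto
    show "\<exists>s\<ge>2*r. sphere 0 s \<subseteq> f ` cball 0 r"
    proof (rule ccontr)
      assume neg: "\<not> ?thesis"
      obtain w1 where w1: "norm w1 = 2*r" "w1 \<notin> f ` cball 0 r"
        using neg by (auto simp: not_le subset_iff)
      have "\<not> sphere 0 (4*r) \<subseteq> f ` cball 0 r"
        using neg \<open>r > 0\<close> by (auto dest: spec [of _ "4*r"])
      then obtain w2 where "w2 \<in> sphere 0 (4*r)" "w2 \<notin> f ` cball 0 r" by blast
      then have w2: "norm w2 = 4*r" "w2 \<notin> f ` cball 0 r" by auto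
      have ne: "w1 \<noteq> w2" using w1 w2 \<open>r > 0\<close> by auto
      have lo: "2*r \<le> norm (w2 - w1)" using norm_triangle_ineq2 [of w2 w1] w1 w2 by simp
      have hi: "norm (w2 - w1) \<le> 6*r" using norm_triangle_ineq4 [of w2 w1] w1 w2 by simp
      \<comment> \<open>Rescaled so that the unit disc stands for \<open>cball 0 r\<close> and the
        omitted values \<open>w1\<close> and \<open>w2\<close> become 0 and 1.\<close>
      define h where "h = (\<lambda>z. (f (of_real r * z) - w1) / (w2 - w1))"
      have hh: "h holomorphic_on cball 0 1"
        unfolding h_def using ne
        by (intro holomorphic_intros holomorphic_on_compose [OF _ holo, unfolded o_def]) auto
      have in_ball: "of_real r * z \<in> cball 0 r" if "z \<in> cball 0 1" for z :: complex
        using that \<open>r > 0\<close> by (simp add: norm_mult mult_left_le)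
      have omit: "\<not> (h z = 0 \<or> h z = 1)" if "z \<in> cball 0 1" for z
        using in_ball [OF that] w1 w2 ne by (auto simp: h_def field_simps)
      have h0: "norm (h 0) \<le> 2"
      proof -
        have "norm (f 0 - w1) \<le> norm (f 0) + 2*r"
          using norm_triangle_ineq4 [of "f 0" w1] w1 by simp
        also have "\<dots> \<le> 2 * norm (w2 - w1)" using r lo \<open>r > 0\<close> by auto
        finally show ?thesis using ne by (simp add: h_def norm_divide divide_simps)
      qed
      have small: "norm (h z) \<le> C" if "norm z \<le> 1/2" for z
        unfolding C_def by (rule Schottky [OF hh h0 omit _ _ that]) auto
      obtain z where z: "norm z = r/2" "norm (f z) \<ge> (2 * (3 + 6 * C)) * (r/2)"
        using r1(2) [of "r/2"] r by auto
      have "norm (h (z / of_real r)) \<le> C"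
        using small [of "z / of_real r"] z \<open>r > 0\<close> by (simp add: norm_divide)
      then have "norm (f z - w1) \<le> C * norm (w2 - w1)"
        using ne \<open>r > 0\<close> by (simp add: h_def norm_divide divide_simps)
      also have "\<dots> \<le> C * (6 * r)" using hi \<open>C > 0\<close> by (intro mult_left_mono) auto
      finally have "norm (f z) \<le> 2*r + C * (6*r)"
        using norm_triangle_ineq2 [of "f z" w1] w1 by simp
      moreover have "norm (f z) \<ge> 3*r + C * (6*r)" using z by (simp add: algebra_simps)
      ultimately show False using \<open>r > 0\<close> by linarith
    qed
  qed
qed

text \<open>A large value of \<open>f\<close> at one point says nothing about the next iterate; a
  whole circle in the image of the disc does. Each step at least doubles the radius, so the
  induction leaves \<open>r\<close> free, and the maximum principle moves the point found to the
  circle of radius \<open>r\<close>.\<close>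

lemma iterate_growth:
  obtains r0 where "r0 > 0" "\<And>r n. r \<ge> r0 \<Longrightarrow> \<exists>z. norm z = r \<and> norm ((f ^^ n) z) \<ge> 2 ^ n * r"
proof -
  obtain r0 where r0: "r0 > 0" "\<And>r. r \<ge> r0 \<Longrightarrow> \<exists>s\<ge>2*r. sphere 0 s \<subseteq> f ` cball 0 r"
    using circle_in_image by blast
  have "\<exists>z. norm z = r \<and> norm ((f ^^ n) z) \<ge> 2 ^ n * r" if "r \<ge> r0" for r n
    using that
  proof (induction n arbitrary: r)
    case 0
    show ?case using 0 r0 by (intro exI [of _ "of_real r"]) auto
  next
    case (Suc n)
    have "r > 0" using Suc.prems r0 by linarith
    obtain s where s: "s \<ge> 2*r" "sphere 0 s \<subseteq> f ` cball 0 r"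
      using r0 Suc.prems by blast
    have "s \<ge> r0" using s Suc.prems r0 by linarith
    then obtain z where z: "norm z = s" "norm ((f ^^ n) z) \<ge> 2 ^ n * s"
      using Suc.IH by blast
    obtain w where w: "norm w \<le> r" "f w = z" using s z by auto
    have "2 ^ Suc n * r \<le> 2 ^ n * s" using s by simp
    also have "\<dots> \<le> norm ((f ^^ Suc n) w)" using z w by (simp add: funpow_swap1)
    finally have *: "2 ^ Suc n * r \<le> norm ((f ^^ Suc n) w)" .
    obtain u where "norm u = r" "norm ((f ^^ Suc n) w) \<le> norm ((f ^^ Suc n) u)"
      using max_modulus_sphere [OF holo_iter w(1) \<open>r > 0\<close>] by blast
    with * show ?case by (metis order_trans)
  qed
  with r0(1) show thesis using that by blast
qed

section \<open>Points with bounded orbit\<close>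

definition bounded_orbit :: "complex \<Rightarrow> bool" where
  "bounded_orbit z \<longleftrightarrow> bounded (range (\<lambda>n. (f ^^ n) z))"

lemma bounded_orbit_step: "bounded_orbit (f z) \<Longrightarrow> bounded_orbit z"
proof -
  assume "bounded_orbit (f z)"
  moreover have "range (\<lambda>n. (f ^^ n) z) \<subseteq> insert z (range (\<lambda>n. (f ^^ n) (f z)))"
  proof
    fix w assume "w \<in> range (\<lambda>n. (f ^^ n) z)"
    then obtain n where "w = (f ^^ n) z" by blast
    then show "w \<in> insert z (range (\<lambda>n. (f ^^ n) (f z)))"
      by (cases n) (auto simp: funpow_swap1)
  qed
  ultimately show ?thesis
    unfolding bounded_orbit_def by (meson bounded_insert bounded_subset)
qed

lemma bounded_orbit_iter: "bounded_orbit ((f ^^ n) z) \<Longrightarrow> bounded_orbit z"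
  by (induction n) (auto intro: bounded_orbit_step)

lemma bounded_orbit_period2:
  assumes "f (f p) = p"
  shows "bounded_orbit p"
proof -
  have "(f ^^ n) p \<in> {p, f p}" for n
    using assms by (induction n) auto
  then have "range (\<lambda>n. (f ^^ n) p) \<subseteq> {p, f p}" by blast
  then show ?thesis
    unfolding bounded_orbit_def by (meson bounded_subset finite.intros finite_imp_bounded)
qed

text \<open>\<open>f \<circ> f\<close> has a fixed point. If its orbit is a single point \<open>p\<close> without other preimages, then
  \<open>(f z - p) / (z - p)\<close> omits \<open>0\<close> away from \<open>p\<close> and hence takes the value \<open>1\<close>.\<close>

lemma two_bounded_orbits:
  obtains p q where "p \<noteq> q" "bounded_orbit p" "bounded_orbit q"
proof -
  obtain p where p: "f (f p) = p"
  proof (rule holomorphic_involution_point [OF holo])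
    show "f \<noteq> (\<lambda>x. a + x)" for a
      using not_poly [of "[:a, 1:]"] by (auto simp: fun_eq_iff)
  qed
  show thesis
  \<comment> \<open>If this condition fails, \<open>f p\<close> or another preimage of
    \<open>p\<close> is a second point of bounded orbit.\<close>
  proof (cases "f p = p \<and> (\<forall>z. f z = p \<longrightarrow> z = p)")
    case False
    then show thesis
      using that p bounded_orbit_period2 bounded_orbit_step by metis
  next
    case True
    define g where "g = (\<lambda>z. if z = p then deriv f p else (f z - f p) / (z - p))"
    have g: "g holomorphic_on UNIV"
      unfolding g_def by (rule pole_lemma_open [OF holo]) auto
    have fg: "f z = p + (z - p) * g z" for z
      using True by (auto simp: g_def)
    have "transcendental_entire g"
      unfolding transcendental_entire_def
    proof (intro conjI g notI)
      assume "\<exists>q. g = poly q"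
      then obtain q where "g = poly q" by blast
      then have "f = poly ([:p:] + [:-p, 1:] * q)" using fg by (auto simp: fun_eq_iff algebra_simps)
      then show False using not_poly by blast
    qed
    then obtain a where a: "\<And>w. w \<noteq> a \<Longrightarrow> infinite {z. g z = w}"
      using transcendental_Picard by blast
    have "{z. g z = 0} \<subseteq> {p}" using True by (auto simp: g_def split: if_splits)
    then have "finite {z. g z = 0}" using finite_subset by blast
    then have "a = 0" using a by metis
    then have "infinite ({z. g z = 1} - {p})" using a by simp
    then obtain z where "z \<noteq> p" "g z = 1"
      by (metis (mono_tags, lifting) Diff_iff finite.emptyI insertI1 mem_Collect_eq equals0I)
    then have "f z = z" using fg [of z] by simp
    then show thesis
      using that [OF \<open>z \<noteq> p\<close>] bounded_orbit_period2 p by simp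
  qed
qed

end

section \<open>Invariance of the Fatou and Julia sets\<close>

lemma spherically_convergent_on_compose:
  assumes g: "spherically_convergent_on V g" and fUV: "f ` U \<subseteq> V" and cont: "continuous_on U f"
  shows "spherically_convergent_on U (\<lambda>n z. g n (f z))"
proof -
  have K: "compact (f ` K) \<and> f ` K \<subseteq> V" if "compact K \<and> K \<subseteq> U" for K
    using that fUV by (meson compact_continuous_image cont continuous_on_subset image_mono subset_trans)
  show ?thesis
    using g unfolding spherically_convergent_on_def
  proof (elim disjE exE, goal_cases)
    case (1 l)
    have "uniform_limit K (\<lambda>n z. g n (f z)) (\<lambda>z. l (f z)) sequentially" if "compact K \<and> K \<subseteq> U" for K
      by (rule uniform_limit_compose' [where A = "f ` K"]) (use 1 K [OF that] in auto)
    then show ?case by blast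
  next
    case 2
    have "\<forall>\<^sub>F n in sequentially. \<forall>z\<in>K. B \<le> cmod (g n (f z))" if "compact K \<and> K \<subseteq> U" for K B
      using 2 [rule_format, OF K [OF that], of B] by simp
    then show ?case by blast
  qed
qed

text \<open>Since \<open>f\<close> is open, each compact subset of the image is covered by the image
  of a compact subset of \<open>U\<close>.\<close>

lemma spherically_convergent_on_image:
  assumes g: "spherically_convergent_on U (\<lambda>n z. g n (f z))"
    and U: "open U" and op: "\<And>S. open S \<Longrightarrow> open (f ` S)"
  shows "spherically_convergent_on (f ` U) g"
proof -
  have K: "\<exists>L. compact L \<and> L \<subseteq> U \<and> K \<subseteq> f ` L" if K: "compact K \<and> K \<subseteq> f ` U" for K
  proof -
    define \<C> where "\<C> = {f ` ball v e |v e. e > 0 \<and> cball v e \<subseteq> U}"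
    have "K \<subseteq> \<Union>\<C>"
    proof
      fix w assume "w \<in> K"
      then obtain v where v: "v \<in> U" "w = f v" using K by blast
      then obtain e where "e > 0" "cball v e \<subseteq> U" using U open_contains_cball by blast
      then show "w \<in> \<Union>\<C>" unfolding \<C>_def v by fastforce
    qed
    moreover have "\<forall>C\<in>\<C>. open C" by (auto simp: \<C>_def op)
    ultimately obtain \<D> where \<D>: "\<D> \<subseteq> \<C>" "finite \<D>" "K \<subseteq> \<Union>\<D>"
      using K compactE [of K \<C>] by metis
    have "\<forall>C\<in>\<D>. \<exists>L. compact L \<and> L \<subseteq> U \<and> C \<subseteq> f ` L"
    proof
      fix C assume "C \<in> \<D>"
      then obtain v e where "C = f ` ball v e" "cball v e \<subseteq> U" using \<D> by (auto simp: \<C>_def)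
      then show "\<exists>L. compact L \<and> L \<subseteq> U \<and> C \<subseteq> f ` L"
        by (intro exI [of _ "cball v e"]) auto
    qed
    then obtain L where L: "\<And>C. C \<in> \<D> \<Longrightarrow> compact (L C) \<and> L C \<subseteq> U \<and> C \<subseteq> f ` L C" by metis
    have "compact (\<Union>C\<in>\<D>. L C)" using L \<D> by (intro compact_UN) auto
    moreover have "(\<Union>C\<in>\<D>. L C) \<subseteq> U" using L by blast
    moreover have "K \<subseteq> f ` (\<Union>C\<in>\<D>. L C)"
    proof
      fix w assume "w \<in> K"
      then obtain C where "C \<in> \<D>" "w \<in> C" using \<D>(3) by blast
      then show "w \<in> f ` (\<Union>C\<in>\<D>. L C)" using L [of C] by blast
    qed
    ultimately show ?thesis by (intro exI conjI)
  qed
  show ?thesis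
    using g unfolding spherically_convergent_on_def
  proof (elim disjE exE, goal_cases)
    case (1 l)
    have lim: "(\<lambda>n. g n (f v)) \<longlonglongrightarrow> l v" if "v \<in> U" for v
      by (rule tendsto_uniform_limitI [where S = "{v}"]) (use 1 [rule_format, of "{v}"] that in auto)
    \<comment> \<open>A pointwise limit is independent of the choice of preimages under
      \<open>f\<close>, which need not be injective.\<close>
    define \<psi> where "\<psi> = (\<lambda>w. lim (\<lambda>n. g n w))"
    have \<psi>: "\<psi> (f v) = l v" if "v \<in> U" for v
      unfolding \<psi>_def by (rule limI) (rule lim [OF that])
    have "uniform_limit K g \<psi> sequentially" if KU: "compact K \<and> K \<subseteq> f ` U" for K
    proof -
      obtain L where L: "compact L" "L \<subseteq> U" "K \<subseteq> f ` L" using K [OF KU] by metis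
      then have ul: "uniform_limit L (\<lambda>n z. g n (f z)) l sequentially" by (intro 1 [rule_format]) auto
      show ?thesis
      proof (rule uniform_limitI)
        fix e :: real assume "e > 0"
        with ul have "\<forall>\<^sub>F n in sequentially. \<forall>z\<in>L. dist (g n (f z)) (l z) < e"
          by (rule uniform_limitD)
        then show "\<forall>\<^sub>F n in sequentially. \<forall>w\<in>K. dist (g n w) (\<psi> w) < e"
        proof eventually_elim
          case (elim n)
          show ?case
          proof
            fix w assume "w \<in> K"
            then obtain v where "v \<in> L" "w = f v" using L by blast
            then show "dist (g n w) (\<psi> w) < e" using elim L \<psi> [of v] by auto
          qed
        qed
      qed
    qed
    then show ?case by blast
  next
    case 2
    have "\<forall>\<^sub>F n in sequentially. \<forall>w\<in>K. B \<le> cmod (g n w)" if KU: "compact K \<and> K \<subseteq> f ` U" for K B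
    proof -
      obtain L where L: "compact L" "L \<subseteq> U" "K \<subseteq> f ` L" using K [OF KU] by metis
      then have "\<forall>\<^sub>F n in sequentially. \<forall>z\<in>L. B \<le> cmod (g n (f z))" by (intro 2 [rule_format]) auto
      then show ?thesis by eventually_elim (use L in blast)
    qed
    then show ?case by blast
  qed
qed

lemma uniform_limit_imp_bounded:
  fixes h :: "nat \<Rightarrow> complex \<Rightarrow> complex"
  assumes ul: "uniform_limit K h g sequentially" and K: "compact K"
    and cont: "\<And>n. continuous_on K (h n)"
  obtains B where "\<forall>\<^sub>F n in sequentially. \<forall>z\<in>K. norm (h n z) \<le> B"
proof -
  have "continuous_on K g"
    by (rule uniform_limit_theorem [OF _ ul]) (auto simp: cont)
  then have "bounded (g ` K)" using K by (simp add: compact_continuous_image compact_imp_bounded)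
  then obtain B where B: "\<And>z. z \<in> K \<Longrightarrow> norm (g z) \<le> B" by (auto simp: bounded_iff)
  have "\<forall>\<^sub>F n in sequentially. \<forall>z\<in>K. dist (h n z) (g z) < 1"
    by (rule uniform_limitD [OF ul]) simp
  then have "\<forall>\<^sub>F n in sequentially. \<forall>z\<in>K. norm (h n z) \<le> B + 1"
  proof eventually_elim
    case (elim n)
    show ?case
    proof
      fix z assume z: "z \<in> K"
      then have "norm (h n z - g z) < 1" using elim by (simp add: dist_norm)
      then show "norm (h n z) \<le> B + 1" using B [OF z] norm_triangle_ineq2 [of "h n z" "g z"] by linarith
    qed
  qed
  then show thesis using that by blast
qed

lemma strict_mono_subsequence:
  fixes n :: "nat \<Rightarrow> nat"
  assumes "\<And>m. finite {k. n k = m}"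
  obtains r where "strict_mono (r :: nat \<Rightarrow> nat)" "strict_mono (n \<circ> r)"
proof -
  have "\<exists>j>i. n j > n i" for i
  proof (rule ccontr)
    assume "\<not> ?thesis"
    then have "{i<..} \<subseteq> (\<Union>m\<le>n i. {k. n k = m})" by (force simp: not_less)
    moreover have "finite (\<Union>m\<le>n i. {k. n k = m})" using assms by blast
    ultimately show False using finite_subset infinite_Ioi by blast
  qed
  then have "\<exists>r. \<forall>k. True \<and> (r k < r (Suc k) \<and> n (r k) < n (r (Suc k)))"
    by (intro dependent_nat_choice) auto
  then obtain r where "\<And>k. r k < r (Suc k)" "\<And>k. n (r k) < n (r (Suc k))" by blast
  then show thesis by (intro that [of r]) (simp_all add: strict_mono_Suc_iff)
qed

context transcendental_map
begin

lemma normal_iterates_subsequence: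
  assumes "normal_family_on U (range (\<lambda>n. f ^^ n))"
  obtains r where "strict_mono (r :: nat \<Rightarrow> nat)" "spherically_convergent_on U (\<lambda>k. f ^^ n (r k))"
proof -
  have "range (\<lambda>k. f ^^ n k) \<subseteq> range (\<lambda>n. f ^^ n)" by blast
  then show thesis using assms that unfolding normal_family_on_iff o_def by blast
qed

text \<open>A sequence of indices either repeats a value infinitely often, which gives a constant
  subsequence of iterates, or has a strictly increasing subsequence. The reduction later allows
  small indices to be dropped.\<close>

lemma normal_iteratesI:
  assumes "\<And>n. strict_mono (n :: nat \<Rightarrow> nat) \<Longrightarrow>
      \<exists>r :: nat \<Rightarrow> nat. strict_mono r \<and> spherically_convergent_on U (\<lambda>k. f ^^ n (r k))"
  shows "normal_family_on U (range (\<lambda>n. f ^^ n))"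
  unfolding normal_family_on_iff
proof (intro allI impI)
  fix h :: "nat \<Rightarrow> complex \<Rightarrow> complex" assume "range h \<subseteq> range (\<lambda>n. f ^^ n)"
  then have "\<forall>k. \<exists>m. h k = f ^^ m" by blast
  then obtain n where n: "\<And>k. h k = f ^^ n k" by metis
  show "\<exists>r :: nat \<Rightarrow> nat. strict_mono r \<and> spherically_convergent_on U (h \<circ> r)"
  proof (cases "\<exists>m. infinite {k. n k = m}")
    case True
    then obtain m where "infinite {k. n k = m}" by blast
    then obtain r :: "nat \<Rightarrow> nat" where r: "strict_mono r" "\<And>k. n (r k) = m"
      using infinite_enumerate by (metis (mono_tags, lifting) mem_Collect_eq)
    have "spherically_convergent_on U (h \<circ> r)"
      unfolding spherically_convergent_on_def
      by (intro disjI1 exI [of _ "f ^^ m"]) (auto simp: o_def n r intro: uniform_limit_const)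
    with r show ?thesis by blast
  next
    case False
    then obtain r :: "nat \<Rightarrow> nat" where r: "strict_mono r" "strict_mono (n \<circ> r)"
      using strict_mono_subsequence [of n] by blast
    obtain q :: "nat \<Rightarrow> nat" where "strict_mono q" "spherically_convergent_on U (\<lambda>k. f ^^ (n \<circ> r) (q k))"
      using assms [OF r(2)] by blast
    then show ?thesis
      using strict_mono_o [OF r(1), of q] by (intro exI [of _ "r \<circ> q"]) (simp add: o_def n)
  qed
qed

lemma fatouI: "\<lbrakk>open U; connected U; z \<in> U; normal_family_on U (range (\<lambda>n. f ^^ n))\<rbrakk> \<Longrightarrow> z \<in> fatou_set f"
  unfolding fatou_set_def mem_Collect_eq by (rule exI [of _ U]) (intro conjI)

lemma open_fatou: "open (fatou_set f)"
proof (subst open_subopen, intro ballI)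
  fix z assume "z \<in> fatou_set f"
  then obtain U where U: "open U" "connected U" "z \<in> U" "normal_family_on U (range (\<lambda>n. f ^^ n))"
    unfolding fatou_set_def by blast
  then have "U \<subseteq> fatou_set f" using fatouI by blast
  then show "\<exists>T. open T \<and> z \<in> T \<and> T \<subseteq> fatou_set f" using U by blast
qed

lemma closed_julia: "closed (julia_set f)"
  by (simp add: julia_set_def closed_def open_fatou)

lemma fatou_forward: 
  assumes "z \<in> fatou_set f" shows "f z \<in> fatou_set f"
proof -
  obtain U where U: "open U" "connected U" "z \<in> U" "normal_family_on U (range (\<lambda>n. f ^^ n))"
    using assms unfolding fatou_set_def by blast
  show ?thesis
  proof (rule fatouI [of "f ` U"])
    show "connected (f ` U)"
      by (intro connected_continuous_image U holomorphic_on_imp_continuous_on holo)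
    show "normal_family_on (f ` U) (range (\<lambda>n. f ^^ n))"
    proof (rule normal_iteratesI)
      fix n :: "nat \<Rightarrow> nat"
      obtain r where r: "strict_mono r" "spherically_convergent_on U (\<lambda>k. f ^^ Suc (n (r k)))"
        by (rule normal_iterates_subsequence [OF U(4), of "\<lambda>k. Suc (n k)"])
      have "spherically_convergent_on (f ` U) (\<lambda>k. f ^^ n (r k))"
        using r(2) U open_image
        by (intro spherically_convergent_on_image) (auto simp: funpow_Suc_right o_def simp del: funpow.simps)
      with r show "\<exists>r :: nat \<Rightarrow> nat. strict_mono r \<and> spherically_convergent_on (f ` U) (\<lambda>k. f ^^ n (r k))"
        by blast
    qed
  qed (use U open_image in auto)
qed

lemma fatou_backward: 
  assumes "f z \<in> fatou_set f" shows "z \<in> fatou_set f"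
proof -
  obtain V where V: "open V" "connected V" "f z \<in> V" "normal_family_on V (range (\<lambda>n. f ^^ n))"
    using assms unfolding fatou_set_def by blast
  have "open (f -` V)"
    using V(1) holo holomorphic_on_imp_continuous_on open_vimage by blast
  then obtain e where e: "e > 0" "ball z e \<subseteq> f -` V"
    using V(3) openE by blast
  show ?thesis
  proof (rule fatouI [of "ball z e"])
    show "normal_family_on (ball z e) (range (\<lambda>n. f ^^ n))"
    proof (rule normal_iteratesI)
      fix n :: "nat \<Rightarrow> nat" assume n: "strict_mono n"
      \<comment> \<open>Starting at \<open>Suc\<close> makes every index positive, so that one
        application of \<open>f\<close> can be split off.\<close>
      obtain r where r: "strict_mono r" "spherically_convergent_on V (\<lambda>k. f ^^ (n (Suc (r k)) - 1))"
        by (rule normal_iterates_subsequence [OF V(4), of "\<lambda>k. n (Suc k) - 1"])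
      have "f ^^ n (Suc (r k)) = (\<lambda>z. (f ^^ (n (Suc (r k)) - 1)) (f z))" for k
      proof -
        have "n (Suc (r k)) \<noteq> 0" using n strict_mono_imp_increasing [OF n, of "Suc (r k)"] by simp
        then show ?thesis by (cases "n (Suc (r k))") (auto simp: funpow_Suc_right o_def simp del: funpow.simps)
      qed
      then have "spherically_convergent_on (ball z e) (\<lambda>k. f ^^ n (Suc (r k)))"
        using spherically_convergent_on_compose [OF r(2), of f "ball z e"] e holo
        by (auto simp: holomorphic_on_imp_continuous_on)
      with r show "\<exists>r :: nat \<Rightarrow> nat. strict_mono r \<and> spherically_convergent_on (ball z e) (\<lambda>k. f ^^ n (r k))"
        by (intro exI [of _ "\<lambda>k. Suc (r k)"]) (auto simp: strict_mono_def)
    qed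
  qed (use e in auto)
qed

lemma julia_iff: "f z \<in> julia_set f \<longleftrightarrow> z \<in> julia_set f"
  using fatou_forward [of z] fatou_backward [of z] by (auto simp: julia_set_def)

lemma julia_iter_iff: "(f ^^ n) z \<in> julia_set f \<longleftrightarrow> z \<in> julia_set f"
  by (induction n) (auto simp: julia_iff)

text \<open>Unbounded values on \<open>K\<close> would yield a sequence of iterates without a finite
  limit, and the limit infinity is excluded by the orbit of \<open>w\<close>.\<close>

lemma normal_bounded_orbit:
  assumes U: "normal_family_on U (range (\<lambda>n. f ^^ n))" and w: "w \<in> U" "bounded_orbit w"
    and K: "compact K" "K \<subseteq> U"
  obtains M where "\<And>n z. z \<in> K \<Longrightarrow> norm ((f ^^ n) z) \<le> M"
proof (rule ccontr)
  assume "\<not> thesis"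
  then have "\<forall>M. \<exists>n. \<exists>z\<in>K. norm ((f ^^ n) z) > M" using that by (meson not_le)
  then have "\<forall>k::nat. \<exists>n. \<exists>z\<in>K. norm ((f ^^ n) z) > real k" by blast
  then obtain n where n: "\<And>k. \<exists>z\<in>K. norm ((f ^^ n k) z) > real k" by metis
  obtain r where r: "strict_mono r" "spherically_convergent_on U (\<lambda>k. f ^^ n (r k))"
    by (rule normal_iterates_subsequence [OF U, of n])
  from r(2) show False
    unfolding spherically_convergent_on_def
  proof (elim disjE exE, goal_cases)
    case (1 g)
    then have ul: "uniform_limit K (\<lambda>k. f ^^ n (r k)) g sequentially" using K by blast
    obtain B where "\<forall>\<^sub>F k in sequentially. \<forall>z\<in>K. norm ((f ^^ n (r k)) z) \<le> B"
      by (rule uniform_limit_imp_bounded [OF ul K(1) cont_iter])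
    then obtain N where N: "\<And>k z. k \<ge> N \<Longrightarrow> z \<in> K \<Longrightarrow> norm ((f ^^ n (r k)) z) \<le> B"
      unfolding eventually_sequentially by blast
    define k where "k = max N (nat \<lceil>B\<rceil>)"
    obtain z where z: "z \<in> K" "norm ((f ^^ n (r k)) z) > real (r k)" using n by blast
    have "real (r k) \<ge> B"
      using seq_suble [OF r(1), of k] unfolding k_def by linarith
    moreover have "norm ((f ^^ n (r k)) z) \<le> B" using N [of k z] z(1) by (simp add: k_def)
    ultimately show False using z(2) by linarith
  next
    case 2
    obtain B where B: "\<And>n. norm ((f ^^ n) w) \<le> B"
      using w(2) unfolding bounded_orbit_def bounded_iff by blast
    have "\<forall>\<^sub>F k in sequentially. \<forall>z\<in>{w}. B + 1 \<le> norm ((f ^^ n (r k)) z)"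
      by (intro 2 [rule_format]) (use w in auto)
    then obtain k where "B + 1 \<le> norm ((f ^^ n (r k)) w)"
      by (auto simp: eventually_sequentially)
    with B [of "n (r k)"] show False by linarith
  qed
qed

text \<open>By normality, near each point of \<open>S\<close> either all orbits are bounded, and
  uniformly so, or none is. Connectedness of \<open>S\<close> leaves only the first case, and
  compactness of \<open>K\<close> gives one bound.\<close>

lemma bounded_orbit_component:
  assumes S: "open S" "connected S" "S \<subseteq> fatou_set f" and q: "q \<in> S" "bounded_orbit q"
    and K: "compact K" "K \<subseteq> S"
  obtains M where "\<And>n z. z \<in> K \<Longrightarrow> norm ((f ^^ n) z) \<le> M"
proof -
  define Z where "Z = {z \<in> S. bounded_orbit z}"
  have nbhd: "\<exists>T. open T \<and> z \<in> T \<and> T \<subseteq> S \<and> ((\<exists>w\<in>T. bounded_orbit w) \<longrightarrow>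
      (\<exists>M. \<forall>n. \<forall>u\<in>T. norm ((f ^^ n) u) \<le> M))" if z: "z \<in> S" for z
  proof -
    have "z \<in> fatou_set f" using S(3) z by blast
    then obtain U where U: "open U" "connected U" "z \<in> U" "normal_family_on U (range (\<lambda>n. f ^^ n))"
      unfolding fatou_set_def by blast
    then have "open (U \<inter> S)" "z \<in> U \<inter> S" using S z by auto
    then obtain e where e: "e > 0" "cball z e \<subseteq> U \<inter> S" using open_contains_cball by blast
    have "\<exists>M. \<forall>n. \<forall>u\<in>ball z e. norm ((f ^^ n) u) \<le> M" if w: "w \<in> ball z e" "bounded_orbit w" for w
    proof -
      have "w \<in> U" "cball z e \<subseteq> U" using w e by auto
      then obtain M where "\<And>n u. u \<in> cball z e \<Longrightarrow> norm ((f ^^ n) u) \<le> M"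
        using normal_bounded_orbit [OF U(4) _ w(2) compact_cball] by metis
      then show ?thesis by (meson ball_subset_cball subsetD)
    qed
    moreover have "ball z e \<subseteq> S" using e by auto
    ultimately show ?thesis using e(1) by (intro exI [of _ "ball z e"]) auto
  qed
  then obtain T where T: "\<And>z. z \<in> S \<Longrightarrow> open (T z) \<and> z \<in> T z \<and> T z \<subseteq> S \<and>
      ((\<exists>w\<in>T z. bounded_orbit w) \<longrightarrow> (\<exists>M. \<forall>n. \<forall>u\<in>T z. norm ((f ^^ n) u) \<le> M))"
    by metis
  have bo: "bounded_orbit u" if "\<forall>n. norm ((f ^^ n) u) \<le> M" for u M
    using that unfolding bounded_orbit_def bounded_iff by blast
  have TZ: "T z \<subseteq> Z" if zw: "z \<in> S" "w \<in> T z" "bounded_orbit w" for z w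
  proof -
    obtain M where "\<And>n u. u \<in> T z \<Longrightarrow> norm ((f ^^ n) u) \<le> M"
      using T [OF zw(1)] zw(2,3) by metis
    then show ?thesis using T [OF zw(1)] bo unfolding Z_def by blast
  qed
  have "open Z"
  proof (subst open_subopen, intro ballI)
    fix z assume "z \<in> Z"
    then have z: "z \<in> S" "bounded_orbit z" by (auto simp: Z_def)
    then show "\<exists>A. open A \<and> z \<in> A \<and> A \<subseteq> Z" using T [OF z(1)] TZ [OF z(1) _ z(2)] by blast
  qed
  moreover have "open (S - Z)"
  proof (subst open_subopen, intro ballI)
    fix z assume z: "z \<in> S - Z"
    have zS: "z \<in> S" using z by blast
    have "w \<notin> Z" if "w \<in> T z" for w
    proof
      assume "w \<in> Z"
      then have "T z \<subseteq> Z" using TZ [OF zS that] by (simp add: Z_def)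
      then show False using T [OF zS] z by blast
    qed
    then show "\<exists>A. open A \<and> z \<in> A \<and> A \<subseteq> S - Z" using T [OF zS] by (intro exI [of _ "T z"]) blast
  qed
  ultimately have SZ: "S = Z"
    using connectedD [OF S(2), of Z "S - Z"] q unfolding Z_def by blast
  have "K \<subseteq> \<Union>(T ` S)" using T K by blast
  then obtain \<D> where \<D>: "\<D> \<subseteq> S" "finite \<D>" "K \<subseteq> \<Union>(T ` \<D>)"
    using compactE_image [OF K(1), of S T] T by metis
  have "\<exists>M. \<forall>n. \<forall>u\<in>T z. norm ((f ^^ n) u) \<le> M" if "z \<in> \<D>" for z
    using T [of z] \<D> that SZ unfolding Z_def by blast
  then obtain M where M: "\<And>z n u. z \<in> \<D> \<Longrightarrow> u \<in> T z \<Longrightarrow> norm ((f ^^ n) u) \<le> M z" by metis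
  show thesis
  proof (rule that [of "\<Sum>z\<in>\<D>. \<bar>M z\<bar>"])
    fix n u assume "u \<in> K"
    then obtain z where z: "z \<in> \<D>" "u \<in> T z" using \<D> by blast
    then have "norm ((f ^^ n) u) \<le> \<bar>M z\<bar>" using M by (meson abs_ge_self order_trans)
    also have "\<dots> \<le> (\<Sum>z\<in>\<D>. \<bar>M z\<bar>)" using z \<D> by (intro member_le_sum) auto
    finally show "norm ((f ^^ n) u) \<le> (\<Sum>z\<in>\<D>. \<bar>M z\<bar>)" .
  qed
qed

lemma no_uniform_bound_on_circle:
  obtains r0 where "r0 > 0" "\<And>r M. r \<ge> r0 \<Longrightarrow> \<forall>\<^sub>F n in sequentially. \<exists>z. norm z = r \<and> norm ((f ^^ n) z) > M"
proof -
  obtain r0 where r0: "r0 > 0" "\<And>r n. r \<ge> r0 \<Longrightarrow> \<exists>z. norm z = r \<and> norm ((f ^^ n) z) \<ge> 2 ^ n * r"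
    using iterate_growth by blast
  have "\<forall>\<^sub>F n in sequentially. \<exists>z. norm z = r \<and> norm ((f ^^ n) z) > M" if "r \<ge> r0" for r M
  proof -
    have "r > 0" using that r0 by linarith
    obtain N where N: "M / r < 2 ^ N" using real_arch_pow [of 2 "M / r"] by auto
    have "\<forall>\<^sub>F n in sequentially. M < 2 ^ n * r"
      using eventually_ge_at_top [of N]
    proof eventually_elim
      case (elim n)
      have "M < 2 ^ N * r" using N \<open>r > 0\<close> by (simp add: divide_simps)
      also have "\<dots> \<le> 2 ^ n * r" using elim \<open>r > 0\<close> by (simp add: power_increasing)
      finally show ?case .
    qed
    then show ?thesis by eventually_elim (use r0 that in \<open>meson less_le_trans\<close>)
  qed
  with r0 show thesis using that by blast
qed

text \<open>Otherwise the Fatou set would be connected, and a single bounded orbit would force the iterates to be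
  bounded on large circles.\<close>

lemma julia_not_singleton: "\<not> julia_set f \<subseteq> {e}"
proof
  assume J: "julia_set f \<subseteq> {e}"
  obtain q where q: "q \<noteq> e" "bounded_orbit q" using two_bounded_orbits by metis
  obtain r0 where r0: "r0 > 0" "\<And>r M. r \<ge> r0 \<Longrightarrow> \<forall>\<^sub>F n in sequentially. \<exists>z. norm z = r \<and> norm ((f ^^ n) z) > M"
    using no_uniform_bound_on_circle by blast
  define r where "r = max r0 (norm e + 1)"
  have conn: "connected (- {e})" using connected_punctured_universe [of e] by simp
  have K: "sphere 0 r \<subseteq> - {e}" by (auto simp: r_def)
  have F: "- {e} \<subseteq> fatou_set f" using J by (auto simp: julia_set_def)
  obtain M where M: "\<And>n z. z \<in> sphere 0 r \<Longrightarrow> norm ((f ^^ n) z) \<le> M"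
    using bounded_orbit_component [OF _ conn F _ q(2) compact_sphere K] q(1) by auto
  have "\<forall>\<^sub>F n in sequentially. \<exists>z. norm z = r \<and> norm ((f ^^ n) z) > M" using r0 by (simp add: r_def)
  then obtain n z where "norm z = r" "norm ((f ^^ n) z) > M" by (auto simp: eventually_sequentially)
  with M [of z n] show False by simp
qed

end

section \<open>Blow-up and continua in the Julia set\<close>

lemma locally_connectedE:
  assumes S: "locally connected S" and x: "x \<in> S" "x \<in> V" "open V"
  obtains W C where "open W" "x \<in> W" "S \<inter> W \<subseteq> C" "connected C" "C \<subseteq> S \<inter> V"
proof -
  have "openin (top_of_set S) (S \<inter> V)" using x by auto
  then obtain u C where u: "openin (top_of_set S) u" "connected C" "x \<in> u" "u \<subseteq> C" "C \<subseteq> S \<inter> V"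
    using locallyE [OF S] x by (metis IntI)
  then obtain W where "open W" "u = S \<inter> W" by (auto simp: openin_open)
  with u show thesis by (intro that [of W C]) auto
qed

context transcendental_map
begin

text \<open>Late iterates omitting both values would be normal near a Julia point by Montel's
  theorem. The index \<open>n\<close> still depends on the values; \<open>strong_blow_up\<close>
  removes this for values that \<open>f\<close> takes infinitely often.\<close>

lemma weak_blow_up:
  assumes V: "open V" "V \<inter> julia_set f \<noteq> {}" and "a \<noteq> b"
  obtains n where "n \<ge> n0" "a \<in> (f ^^ n) ` V \<or> b \<in> (f ^^ n) ` V"
proof (rule ccontr)
  assume "\<not> thesis"
  then have "\<not> (\<exists>n\<ge>n0. a \<in> (f ^^ n) ` V \<or> b \<in> (f ^^ n) ` V)" using that by blast
  then have omit: "(f ^^ n) z \<noteq> a \<and> (f ^^ n) z \<noteq> b" if "n \<ge> n0" "z \<in> V" for n z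
    using that by (metis image_eqI)
  obtain z where z: "z \<in> V" "z \<in> julia_set f" using V by blast
  obtain e where e: "e > 0" "ball z e \<subseteq> V" using V z openE by blast
  have "z \<in> fatou_set f"
  proof (rule fatouI [of "ball z e"])
    show "normal_family_on (ball z e) (range (\<lambda>n. f ^^ n))"
    proof (rule normal_iteratesI)
      fix n :: "nat \<Rightarrow> nat" assume n: "strict_mono n"
      obtain r where r: "strict_mono (r :: nat \<Rightarrow> nat)"
          "spherically_convergent_on (ball z e) ((\<lambda>k. f ^^ n (k + n0)) \<circ> r)"
      proof (rule Montel_omits_two [of "ball z e" "\<lambda>k. f ^^ n (k + n0)" a b])
        show "(f ^^ n (k + n0)) w \<noteq> a \<and> (f ^^ n (k + n0)) w \<noteq> b" if "w \<in> ball z e" for k w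
          using omit [of "n (k + n0)" w] that e strict_mono_imp_increasing [OF n, of "k + n0"] by auto
      qed (use \<open>a \<noteq> b\<close> holo_iter in auto)
      then show "\<exists>r :: nat \<Rightarrow> nat. strict_mono r \<and> spherically_convergent_on (ball z e) (\<lambda>k. f ^^ n (r k))"
        by (intro exI [of _ "\<lambda>k. r k + n0"]) (auto simp: strict_mono_def o_def)
    qed
  qed (use e in auto)
  with z show False by (simp add: julia_set_def)
qed

lemma weak_blow_up_omitted:
  assumes V: "open V" "V \<inter> julia_set f \<noteq> {}"
  shows "\<exists>c. \<forall>w. w \<noteq> c \<longrightarrow> (\<exists>n\<ge>n0. w \<in> (f ^^ n) ` V)"
proof (cases "\<exists>c. \<forall>n\<ge>n0. c \<notin> (f ^^ n) ` V")
  case True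
  then obtain c where c: "\<And>n. n \<ge> n0 \<Longrightarrow> c \<notin> (f ^^ n) ` V" by blast
  have "\<exists>n\<ge>n0. w \<in> (f ^^ n) ` V" if "w \<noteq> c" for w
  proof -
    obtain n where "n \<ge> n0" "w \<in> (f ^^ n) ` V \<or> c \<in> (f ^^ n) ` V"
      using weak_blow_up [OF V \<open>w \<noteq> c\<close>] by blast
    then show ?thesis using c by blast
  qed
  then show ?thesis by blast
qed blast

text \<open>One of two points of bounded orbit is pulled back into \<open>V\<close>. Such orbits
  arbitrarily close to a Julia point will rule out the limit infinity.\<close>

lemma bounded_orbit_near_julia:
  assumes V: "open V" "V \<inter> julia_set f \<noteq> {}"
  obtains v where "v \<in> V" "bounded_orbit v"
proof -
  obtain p q where "p \<noteq> q" "bounded_orbit p" "bounded_orbit q" using two_bounded_orbits by metis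
  then obtain n x where "bounded_orbit x" "x \<in> (f ^^ n) ` V"
    using weak_blow_up [OF V, of p q] by metis
  then show thesis using that bounded_orbit_iter by blast
qed

text \<open>If \<open>x\<close> were omitted for infinitely many \<open>n\<close>, so would be two of its preimages one step earlier, and Montel's
  theorem gives a convergent subsequence on a disc. Points with bounded orbit exclude the limit infinity;
  a finite limit is impossible because the disc is blown up over a circle on which the iterates
  tend to infinity in maximum norm.\<close>

lemma strong_blow_up:
  assumes V: "open V" "V \<inter> julia_set f \<noteq> {}" and x: "infinite {z. f z = x}"
  shows "\<forall>\<^sub>F n in sequentially. x \<in> (f ^^ n) ` V"
proof (rule ccontr)
  assume neg: "\<not> ?thesis"
  obtain z where z: "z \<in> V" "z \<in> julia_set f" using V by blast
  obtain e where e: "e > 0" "ball z e \<subseteq> V" using V z openE by blast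
  obtain y where y: "f y = x" using x not_finite_existsD by blast
  have "infinite ({z. f z = x} - {y})" using x by simp
  then have "{z. f z = x} - {y} \<noteq> {}" by (rule infinite_imp_nonempty)
  then obtain y' where y': "f y' = x" "y' \<noteq> y" by blast
  have "infinite {n. x \<notin> (f ^^ Suc n) ` V}"
  proof
    assume "finite {n. x \<notin> (f ^^ Suc n) ` V}"
    then obtain m where m: "\<And>n. x \<notin> (f ^^ Suc n) ` V \<Longrightarrow> n < m"
      unfolding finite_nat_set_iff_bounded by blast
    have "x \<in> (f ^^ n) ` V" if "n \<ge> Suc m" for n
      using that m [of "n - 1"] by (cases n) (auto simp del: funpow.simps)
    then show False using neg unfolding eventually_sequentially by blast
  qed
  then obtain s :: "nat \<Rightarrow> nat" where s: "strict_mono s" "\<And>k. x \<notin> (f ^^ Suc (s k)) ` V"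
    using infinite_enumerate by blast
  have omit: "(f ^^ s k) u \<noteq> y \<and> (f ^^ s k) u \<noteq> y'" if "u \<in> V" for k u
  proof -
    have "(f ^^ Suc (s k)) u \<noteq> x" using s(2) [of k] that by blast
    then show ?thesis using y y' by auto
  qed
  obtain r where r: "strict_mono (r :: nat \<Rightarrow> nat)"
      "spherically_convergent_on (ball z e) ((\<lambda>k. f ^^ s k) \<circ> r)"
  proof (rule Montel_omits_two [of "ball z e" "\<lambda>k. f ^^ s k" y y'])
    show "(f ^^ s k) u \<noteq> y \<and> (f ^^ s k) u \<noteq> y'" if "u \<in> ball z e" for k u
      using omit that e by blast
  qed (use y'(2) holo_iter in auto)
  define n where "n = s \<circ> r"
  have n: "strict_mono n" using s r by (simp add: n_def strict_mono_o)
  have "spherically_convergent_on (ball z e) (\<lambda>k. f ^^ n k)"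
    using r(2) by (simp add: n_def o_def)
  then show False
    unfolding spherically_convergent_on_def
  proof (elim disjE exE, goal_cases)
    case 2
    have "ball z e \<inter> julia_set f \<noteq> {}" using z e by (metis IntI centre_in_ball empty_iff)
    then obtain v where v: "v \<in> ball z e" "bounded_orbit v"
      using bounded_orbit_near_julia [OF open_ball] by blast
    obtain B where B: "\<And>n. norm ((f ^^ n) v) \<le> B"
      using v(2) unfolding bounded_orbit_def bounded_iff by blast
    have "\<forall>\<^sub>F k in sequentially. \<forall>z\<in>{v}. B + 1 \<le> norm ((f ^^ n k) z)"
      by (intro 2 [rule_format]) (use v in auto)
    then obtain k where "B + 1 \<le> norm ((f ^^ n k) v)"
      by (auto simp: eventually_sequentially)
    with B [of "n k"] show False by linarith
  next
    case (1 g)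
    let ?K = "cball z (e/2)" and ?V = "ball z (e/2)"
    have ul: "uniform_limit ?K (\<lambda>k. f ^^ n k) g sequentially"
      by (intro 1 [rule_format]) (use e in auto)
    obtain M where M: "\<forall>\<^sub>F k in sequentially. \<forall>u\<in>?K. norm ((f ^^ n k) u) \<le> M"
      by (rule uniform_limit_imp_bounded [OF ul compact_cball cont_iter])
    have VJ: "?V \<inter> julia_set f \<noteq> {}" using z e by (metis IntI centre_in_ball empty_iff half_gt_zero)
    obtain c where c: "\<forall>w. w \<noteq> c \<longrightarrow> (\<exists>n\<ge>0. w \<in> (f ^^ n) ` ?V)"
      by (rule exE [OF weak_blow_up_omitted [OF open_ball VJ, of 0]])
    obtain r0 where r0: "r0 > 0" "\<And>r M. r \<ge> r0 \<Longrightarrow> \<forall>\<^sub>F n in sequentially. \<exists>z. norm z = r \<and> norm ((f ^^ n) z) > M"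
      using no_uniform_bound_on_circle by blast
    \<comment> \<open>Large enough for the growth of the iterates, and for the circle to miss the
      exceptional point \<open>c\<close>, so that finitely many images of the half-size disc cover
      it.\<close>
    define \<rho> where "\<rho> = max r0 (norm c + 1)"
    have "sphere 0 \<rho> \<subseteq> (\<Union>j. (f ^^ j) ` ?V)"
    proof
      fix w :: complex assume "w \<in> sphere 0 \<rho>"
      then have "w \<noteq> c" by (auto simp: \<rho>_def)
      then show "w \<in> (\<Union>j. (f ^^ j) ` ?V)" using c by blast
    qed
    then obtain D where D: "finite D" "sphere 0 \<rho> \<subseteq> (\<Union>j\<in>D. (f ^^ j) ` ?V)"
      using compactE_image [OF compact_sphere, of UNIV "\<lambda>j. (f ^^ j) ` ?V"] open_image_iter by (metis open_ball)
    have bd: "bounded (\<Union>j\<in>D. (f ^^ j) ` cball 0 M)"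
      using D by (intro bounded_UN ballI compact_imp_bounded compact_continuous_image cont_iter compact_cball)
    obtain M' where "\<forall>u\<in>(\<Union>j\<in>D. (f ^^ j) ` cball 0 M). norm u \<le> M'"
      using bd unfolding bounded_iff by blast
    then have M': "\<And>j w. \<lbrakk>j \<in> D; norm w \<le> M\<rbrakk> \<Longrightarrow> norm ((f ^^ j) w) \<le> M'"
      by auto
    have "\<forall>\<^sub>F k in sequentially. \<exists>z. norm z = \<rho> \<and> norm ((f ^^ k) z) > M'"
      by (rule r0(2)) (simp add: \<rho>_def)
    then have "\<forall>\<^sub>F k in sequentially. \<exists>z. norm z = \<rho> \<and> norm ((f ^^ n k) z) > M'"
      by (rule eventually_compose_filterlim [OF _ filterlim_subseq [OF n]])
    then have "\<forall>\<^sub>F k in sequentially. False"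
      using M
    proof eventually_elim
      case (elim k)
      then obtain w where w: "norm w = \<rho>" "norm ((f ^^ n k) w) > M'" by blast
      then have "w \<in> sphere 0 \<rho>" by simp
      with D obtain j v where j: "j \<in> D" "v \<in> ?V" "w = (f ^^ j) v" by blast
      \<comment> \<open>Iterates commute: the value at \<open>w\<close> is the image, under one of
        finitely many fixed iterates, of a point of modulus at most \<open>M\<close>.\<close>
      have "(f ^^ n k) w = (f ^^ j) ((f ^^ n k) v)"
        unfolding j(3) by (metis add.commute comp_apply funpow_add)
      moreover have "norm ((f ^^ n k) v) \<le> M" using elim j by auto
      ultimately show False using M' [OF j(1)] w by (metis not_le)
    qed
    then show False by simp
  qed
qed

text \<open>A Julia point other than Picard's exceptional value has infinitely many preimages, all
  in the Julia set.\<close>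

lemma infinite_julia: "infinite (julia_set f)"
proof -
  obtain a where a: "\<And>w. w \<noteq> a \<Longrightarrow> infinite {z. f z = w}"
    using transcendental_Picard [OF transcendental] by blast
  obtain z where z: "z \<in> julia_set f" "z \<noteq> a" using julia_not_singleton [of a] by blast
  have "{w. f w = z} \<subseteq> julia_set f" using z julia_iff by auto
  then show ?thesis using a [OF z(2)] finite_subset by blast
qed

text \<open>One late image of \<open>V\<close> covers two distinct Julia points; their preimages in
  \<open>V\<close> are distinct Julia points, so one of them differs from \<open>c\<close>.\<close>

lemma julia_perfect:
  assumes V: "open V" "V \<inter> julia_set f \<noteq> {}"
  obtains q where "q \<in> V" "q \<in> julia_set f" "q \<noteq> c"
proof -
  obtain a where a: "\<And>w. w \<noteq> a \<Longrightarrow> infinite {z. f z = w}"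
    using transcendental_Picard [OF transcendental] by blast
  obtain x where x: "x \<in> julia_set f" "x \<noteq> a"
    using infinite_julia julia_not_singleton [of a] by blast
  have "infinite (julia_set f - {a, x})" using infinite_julia by simp
  then have "julia_set f - {a, x} \<noteq> {}" by (rule infinite_imp_nonempty)
  then obtain x' where x': "x' \<in> julia_set f" "x' \<noteq> a" "x' \<noteq> x" by blast
  have "\<forall>\<^sub>F n in sequentially. x \<in> (f ^^ n) ` V \<and> x' \<in> (f ^^ n) ` V"
    using strong_blow_up [OF V] a x x' by (simp add: eventually_conj)
  then obtain n v v' where v: "v \<in> V" "v' \<in> V" "(f ^^ n) v = x" "(f ^^ n) v' = x'"
    by (auto simp: eventually_sequentially)
  then have "v \<in> julia_set f" "v' \<in> julia_set f" "v \<noteq> v'"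
    using julia_iter_iff x x' by blast+
  then show thesis using that v by metis
qed

text \<open>A connected neighbourhood \<open>C\<close> of \<open>z\<close> in the Julia set is chosen so that all late images of \<open>C\<close> contain \<open>z\<close>;
  their finite unions are therefore connected. One exceptional point \<open>c\<close> may be missed by all images, and
  is covered by a connected neighbourhood of its own.\<close>

lemma julia_continuum:
  assumes LC: "locally connected (julia_set f)"
  obtains L where "compact L" "connected L" "L \<subseteq> julia_set f" "julia_set f \<inter> cball 0 R \<subseteq> L"
proof -
  let ?J = "julia_set f"
  obtain a where a: "\<And>w. w \<noteq> a \<Longrightarrow> infinite {z. f z = w}"
    using transcendental_Picard [OF transcendental] by blast
  obtain z where z: "z \<in> ?J" "z \<noteq> a" using julia_not_singleton [of a] by blast
  obtain V C where V: "open V" "z \<in> V" "?J \<inter> V \<subseteq> C" and C: "connected C" "C \<subseteq> ?J \<inter> ball z 1"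
    using locally_connectedE [OF LC z(1), of "ball z 1"] by auto
  have VJ: "V \<inter> ?J \<noteq> {}" using V z by blast
  obtain n0 where n0: "\<And>n. n \<ge> n0 \<Longrightarrow> z \<in> (f ^^ n) ` V"
    using strong_blow_up [OF V(1) VJ a [OF z(2)]] unfolding eventually_sequentially by metis
  have VC: "?J \<inter> (f ^^ n) ` V \<subseteq> (f ^^ n) ` C" for n
  proof
    fix w assume "w \<in> ?J \<inter> (f ^^ n) ` V"
    then obtain v where "v \<in> V" "w = (f ^^ n) v" "(f ^^ n) v \<in> ?J" by blast
    then show "w \<in> (f ^^ n) ` C" using V(3) by (simp add: julia_iter_iff) blast
  qed
  have CJ: "(f ^^ n) ` C \<subseteq> ?J" for n
  proof
    fix w assume "w \<in> (f ^^ n) ` C"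
    then obtain v where "v \<in> C" "w = (f ^^ n) v" by blast
    then show "w \<in> ?J" using C(2) by (simp add: julia_iter_iff) blast
  qed
  define Y where "Y = (\<lambda>D. \<Union>n\<in>D. (f ^^ n) ` C)"
  have bC: "bounded ((f ^^ n) ` C)" for n
  proof -
    have "bounded ((f ^^ n) ` cball z 1)"
      by (intro compact_imp_bounded compact_continuous_image cont_iter compact_cball)
    moreover have "C \<subseteq> cball z 1" using C(2) by auto
    ultimately show ?thesis by (meson bounded_subset image_mono)
  qed
  have Y: "connected (Y D)" "bounded (Y D)" "Y D \<subseteq> ?J" if "finite D" "D \<subseteq> {n0..}" for D
  proof -
    show "connected (Y D)"
      unfolding Y_def
    proof (rule connected_Union)
      show "\<And>S. S \<in> (\<lambda>n. (f ^^ n) ` C) ` D \<Longrightarrow> connected S"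
        using C(1) cont_iter connected_continuous_image by blast
      have "z \<in> (f ^^ n) ` C" if "n \<in> D" for n
        using n0 [of n] VC [of n] that \<open>D \<subseteq> {n0..}\<close> z(1) by auto
      then show "\<Inter> ((\<lambda>n. (f ^^ n) ` C) ` D) \<noteq> {}" by blast
    qed
    show "bounded (Y D)" unfolding Y_def using that bC by blast
    show "Y D \<subseteq> ?J" unfolding Y_def using CJ by blast
  qed
  obtain c where c: "\<forall>w. w \<noteq> c \<longrightarrow> (\<exists>n\<ge>n0. w \<in> (f ^^ n) ` V)"
    by (rule exE [OF weak_blow_up_omitted [OF V(1) VJ, of n0]])
  have cover: "\<exists>D. finite D \<and> D \<subseteq> {n0..} \<and> T \<subseteq> Y D" if T: "compact T" "T \<subseteq> ?J - {c}" for T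
  proof -
    have "T \<subseteq> (\<Union>n\<in>{n0..}. (f ^^ n) ` V)"
    proof
      fix w assume "w \<in> T"
      then have "w \<noteq> c" using T(2) by blast
      then obtain n where "n \<ge> n0" "w \<in> (f ^^ n) ` V" using c by blast
      then show "w \<in> (\<Union>n\<in>{n0..}. (f ^^ n) ` V)" by blast
    qed
    then obtain D where D: "D \<subseteq> {n0..}" "finite D" "T \<subseteq> (\<Union>n\<in>D. (f ^^ n) ` V)"
      using compactE_image [OF T(1), of "{n0..}" "\<lambda>n. (f ^^ n) ` V"] open_image_iter [OF V(1)] by metis
    have "T \<subseteq> Y D"
    proof
      fix w assume w: "w \<in> T"
      then obtain n where n: "n \<in> D" "w \<in> (f ^^ n) ` V" using D(3) by blast
      then have "w \<in> (f ^^ n) ` C" using VC [of n] w T(2) by blast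
      with n(1) show "w \<in> Y D" unfolding Y_def by blast
    qed
    with D show ?thesis by blast
  qed
  note witness = that
  have fin: thesis if "connected S" "bounded S" "S \<subseteq> ?J" "?J \<inter> cball 0 R \<subseteq> S" for S
  proof (rule witness)
    show "compact (closure S)" using \<open>bounded S\<close> by simp
    show "connected (closure S)" using \<open>connected S\<close> by (rule connected_imp_connected_closure)
    show "closure S \<subseteq> ?J" using \<open>S \<subseteq> ?J\<close> closed_julia by (rule closure_minimal)
    show "?J \<inter> cball 0 R \<subseteq> closure S" using \<open>?J \<inter> cball 0 R \<subseteq> S\<close> closure_subset by blast
  qed
  show thesis
  proof (cases "c \<in> ?J")
    case False
    have "compact (?J \<inter> cball 0 R)" using closed_julia by (simp add: closed_Int_compact)
    moreover have "?J \<inter> cball 0 R \<subseteq> ?J - {c}" using False by blast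
    ultimately obtain D where D: "finite D" "D \<subseteq> {n0..}" "?J \<inter> cball 0 R \<subseteq> Y D"
      using cover by metis
    show thesis by (rule fin [OF Y [OF D(1,2)] D(3)])
  next
    case True
    obtain W B where W: "open W" "c \<in> W" "?J \<inter> W \<subseteq> B" and B: "connected B" "B \<subseteq> ?J \<inter> ball c 1"
      using locally_connectedE [OF LC True, of "ball c 1"] by auto
    obtain \<delta> where \<delta>: "\<delta> > 0" "ball c \<delta> \<subseteq> W" using W openE by blast
    have "ball c \<delta> \<inter> ?J \<noteq> {}" using True \<delta> by (metis IntI centre_in_ball empty_iff)
    then obtain q where q: "q \<in> ball c \<delta>" "q \<in> ?J" "q \<noteq> c"
      using julia_perfect [OF open_ball] by metis
    \<comment> \<open>The removed disc lies in \<open>W\<close>, so its Julia points are in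
      \<open>B\<close>; the point \<open>q\<close> on its rim belongs to both \<open>T\<close> and
      \<open>B\<close> and links the two pieces.\<close>
    define T where "T = ?J \<inter> (cball 0 (max R (norm q)) - ball c (dist c q))"
    have "compact T" unfolding T_def
      using closed_julia by (intro closed_Int_compact compact_diff) auto
    moreover have "T \<subseteq> ?J - {c}" using q by (auto simp: T_def)
    ultimately obtain D where D: "finite D" "D \<subseteq> {n0..}" "T \<subseteq> Y D"
      using cover by metis
    have qT: "q \<in> T" using q by (auto simp: T_def)
    have qB: "q \<in> B" using q \<delta> W by blast
    show thesis
    proof (rule fin [of "Y D \<union> B"])
      show "connected (Y D \<union> B)"
        using Y [OF D(1,2)] B qT qB D(3) by (intro connected_Un) auto
      have "bounded B" using B(2) by (meson bounded_ball bounded_subset le_inf_iff)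
      then show "bounded (Y D \<union> B)" using Y [OF D(1,2)] by simp
      show "Y D \<union> B \<subseteq> ?J" using Y [OF D(1,2)] B by blast
      show "?J \<inter> cball 0 R \<subseteq> Y D \<union> B"
      proof
        fix w assume w: "w \<in> ?J \<inter> cball 0 R"
        show "w \<in> Y D \<union> B"
        proof (cases "w \<in> ball c (dist c q)")
          case True
          then have "w \<in> W" using q \<delta> by auto
          then show ?thesis using W w by blast
        next
          case False
          then have "w \<in> T" using w by (auto simp: T_def)
          then show ?thesis using D by blast
        qed
      qed
    qed
  qed
qed

lemma connected_julia:
  assumes LC: "locally connected (julia_set f)"
  shows "connected (julia_set f)"
  unfolding connected_iff_connected_component
proof (intro ballI)
  fix x y assume xy: "x \<in> julia_set f" "y \<in> julia_set f"
  obtain L where L: "connected L" "L \<subseteq> julia_set f" "julia_set f \<inter> cball 0 (max (norm x) (norm y)) \<subseteq> L"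
    using julia_continuum [OF LC] by metis
  then show "connected_component (julia_set f) x y"
    unfolding connected_component_def using xy by (intro exI [of _ L]) auto
qed

end

section \<open>Theta curves\<close>

lemma connected_subset_inside:
  assumes "connected X" "X \<inter> S = {}" "X \<inter> inside S \<noteq> {}"
  shows "X \<subseteq> inside S"
proof
  fix y assume y: "y \<in> X"
  obtain x where x: "x \<in> X" "x \<in> inside S" using assms by blast
  have "connected_component (- S) x y"
    unfolding connected_component_def using assms x y by (intro exI [of _ X]) auto
  then show "y \<in> inside S" using x inside_same_component by blast
qed

lemma Jordan_two_arcs:
  fixes c d :: "real \<Rightarrow> complex"
  assumes c: "arc c" "pathstart c = a" "pathfinish c = b"
    and d: "arc d" "pathstart d = a" "pathfinish d = b"
    and cd: "path_image c \<inter> path_image d = {a,b}"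
  defines "S \<equiv> path_image c \<union> path_image d"
  shows "inside S \<noteq> {}" "open (inside S)" "connected (inside S)" "bounded (inside S)"
    "frontier (inside S) = S" "connected (outside S)"
proof -
  have 1: "simple_path (c +++ reversepath d)"
    using assms by (subst simple_path_join_loop_eq) (auto simp: arc_reversepath)
  have 2: "pathfinish (c +++ reversepath d) = pathstart (c +++ reversepath d)"
    using assms by simp
  have "path_image (c +++ reversepath d) = S"
    using assms by (simp add: path_image_join)
  then show "inside S \<noteq> {}" "open (inside S)" "connected (inside S)" "bounded (inside S)"
    "frontier (inside S) = S" "connected (outside S)"
    using Jordan_inside_outside [OF 1 2] by auto
qed

lemma arc_interior_nonempty:
  fixes c :: "real \<Rightarrow> complex"
  assumes "arc c" "pathstart c = a" "pathfinish c = b"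
  obtains x where "x \<in> path_image c" "x \<noteq> a" "x \<noteq> b"
  using nonempty_simple_path_endless [OF arc_imp_simple_path [OF assms(1)]] assms by auto

locale theta_curve =
  fixes c1 c2 c3 :: "real \<Rightarrow> complex" and a b :: complex
  assumes c1: "arc c1" "pathstart c1 = a" "pathfinish c1 = b"
    and c2: "arc c2" "pathstart c2 = a" "pathfinish c2 = b"
    and c3: "arc c3" "pathstart c3 = a" "pathfinish c3 = b"
    and c12: "path_image c1 \<inter> path_image c2 = {a,b}"
    and c13: "path_image c1 \<inter> path_image c3 = {a,b}"
    and c23: "path_image c2 \<inter> path_image c3 = {a,b}"
begin

lemma rotate: "theta_curve c2 c3 c1 a b" 
  using c1 c2 c3 c12 c13 c23 by unfold_locales auto

lemma swap: "theta_curve c2 c1 c3 a b" 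
  using c1 c2 c3 c12 c13 c23 by unfold_locales auto

text \<open>If the insides met, each would lie in the other, as neither meets the other's bounding
  curve. Then their frontiers would agree, but the interior points of \<open>c1\<close> belong to
  only one of them.\<close>

lemma insides_disjoint:
  assumes "path_image c3 \<inter> inside (path_image c1 \<union> path_image c2) = {}"
    and "path_image c1 \<inter> inside (path_image c2 \<union> path_image c3) = {}"
  shows "inside (path_image c1 \<union> path_image c2) \<inter> inside (path_image c2 \<union> path_image c3) = {}"
proof (rule ccontr)
  assume ne: "\<not> ?thesis"
  let ?A = "path_image c1 \<union> path_image c2" and ?B = "path_image c2 \<union> path_image c3"
  note A = Jordan_two_arcs [OF c1 c2 c12] and B = Jordan_two_arcs [OF c2 c3 c23]
  have "inside ?A \<subseteq> inside ?B"
    by (rule connected_subset_inside [OF A(3)]) (use assms ne inside_no_overlap [of ?A] in blast)+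
  moreover have "inside ?B \<subseteq> inside ?A"
    by (rule connected_subset_inside [OF B(3)]) (use assms ne inside_no_overlap [of ?B] in blast)+
  ultimately have "?A = ?B" using A(5) B(5) by (metis subset_antisym)
  moreover obtain x where "x \<in> path_image c1" "x \<noteq> a" "x \<noteq> b"
    using arc_interior_nonempty [OF c1] by blast
  ultimately show False using c12 c13 by blast
qed

text \<open>Otherwise the three insides are pairwise disjoint, and the closures of two of them meet
  exactly in an arc. By Janiszewski's theorem the complement of their union is connected; it meets
  the third inside and misses the curve around it, so it is bounded, and so would be the
  plane.\<close>

lemma some_arc_inside:
  "path_image c3 \<inter> inside (path_image c1 \<union> path_image c2) \<noteq> {} \<or>
   path_image c1 \<inter> inside (path_image c2 \<union> path_image c3) \<noteq> {} \<or>
   path_image c2 \<inter> inside (path_image c1 \<union> path_image c3) \<noteq> {}"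
proof (rule ccontr)
  let ?A = "path_image c1 \<union> path_image c2" and ?B = "path_image c2 \<union> path_image c3"
    and ?D = "path_image c1 \<union> path_image c3"
  note A = Jordan_two_arcs [OF c1 c2 c12] and B = Jordan_two_arcs [OF c2 c3 c23]
    and D = Jordan_two_arcs [OF c1 c3 c13]
  assume "\<not> ?thesis"
  then have neg: "path_image c3 \<inter> inside ?A = {}" "path_image c1 \<inter> inside ?B = {}" "path_image c2 \<inter> inside ?D = {}"
    by auto
  have AB: "inside ?A \<inter> inside ?B = {}" using insides_disjoint neg by blast
  have AD: "inside ?A \<inter> inside ?D = {}"
    using theta_curve.insides_disjoint [OF swap] neg by (metis Un_commute)
  have BD: "inside ?B \<inter> inside ?D = {}"
    using theta_curve.insides_disjoint [OF rotate] neg by (metis Un_commute)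
  have clA: "closure (inside ?A) = inside ?A \<union> ?A" "closure (inside ?B) = inside ?B \<union> ?B"
    using A(5) B(5) by (simp_all add: closure_Un_frontier)
  have "connected (- (closure (inside ?A) \<union> closure (inside ?B)))"
  proof (rule Janiszewski_connected)
    show "compact (closure (inside ?A))" "closed (closure (inside ?B))" using A(4) by auto
    have "closure (inside ?A) \<inter> closure (inside ?B) = path_image c2"
    proof -
      have *: "(I \<union> (P \<union> Q)) \<inter> (K \<union> (Q \<union> R)) = Q"
        if "I \<inter> K = {}" "R \<inter> I = {}" "P \<inter> K = {}" "I \<inter> (P \<union> Q) = {}" "K \<inter> (Q \<union> R) = {}" "P \<inter> R \<subseteq> Q"
        for I K P Q R :: "complex set"
        using that by blast
      have "path_image c1 \<inter> path_image c3 \<subseteq> path_image c2" using c13 c12 by blast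
      then show ?thesis unfolding clA by (intro * AB neg inside_no_overlap)
    qed
    then show "connected (closure (inside ?A) \<inter> closure (inside ?B))"
      using c2 by (simp add: connected_arc_image)
    show "connected (- closure (inside ?A))" "connected (- closure (inside ?B))"
      using A(6) B(6) unfolding clA by (simp_all add: outside_inside Un_commute)
  qed
  then have "- (closure (inside ?A) \<union> closure (inside ?B)) \<subseteq> inside ?D"
  proof (rule connected_subset_inside)
    show "- (closure (inside ?A) \<union> closure (inside ?B)) \<inter> ?D = {}" unfolding clA by blast
    have "inside ?D \<subseteq> - (closure (inside ?A) \<union> closure (inside ?B))"
    proof -
      have *: "K \<subseteq> - ((I \<union> (P \<union> Q)) \<union> (I' \<union> (Q \<union> R)))"
        if "I \<inter> K = {}" "I' \<inter> K = {}" "Q \<inter> K = {}" "K \<inter> (P \<union> R) = {}"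
        for I I' K P Q R :: "complex set"
        using that by blast
      show ?thesis unfolding clA by (intro * AD BD neg inside_no_overlap)
    qed
    then show "- (closure (inside ?A) \<union> closure (inside ?B)) \<inter> inside ?D \<noteq> {}" using D(1) by blast
  qed
  then have "UNIV \<subseteq> inside ?D \<union> (closure (inside ?A) \<union> closure (inside ?B))" by blast
  moreover have "bounded (inside ?D \<union> (closure (inside ?A) \<union> closure (inside ?B)))"
    using A(4) B(4) D(4) by (simp add: bounded_closure)
  ultimately show False using bounded_subset not_bounded_UNIV by blast
qed

text \<open>Non-planarity of \<open>K\<^sub>3\<^sub>,\<^sub>3\<close>: the vertices \<open>a\<close>, \<open>b\<close> and \<open>C\<close> are each adjacent to the three arcs.\<close>

lemma no_common_neighbour_aux:
  assumes C: "connected C" "C \<inter> (path_image c1 \<union> path_image c2 \<union> path_image c3) = {}"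
    and T1: "connected T1" "T1 \<inter> C \<noteq> {}" "T1 \<inter> path_image c1 \<noteq> {}" "T1 \<inter> (path_image c2 \<union> path_image c3) = {}"
    and T2: "connected T2" "T2 \<inter> C \<noteq> {}" "T2 \<inter> path_image c2 \<noteq> {}" "T2 \<inter> (path_image c1 \<union> path_image c3) = {}"
    and T3: "connected T3" "T3 \<inter> C \<noteq> {}" "T3 \<inter> path_image c3 \<noteq> {}" "T3 \<inter> (path_image c1 \<union> path_image c2) = {}"
    and ins: "path_image c3 \<inter> inside (path_image c1 \<union> path_image c2) \<noteq> {}"
  shows False
proof -
  \<comment> \<open>Everything attached to \<open>C\<close> off the curve \<open>S\<close>, namely
    \<open>T\<close> and the open arc of \<open>c\<close>, lies on the same side of \<open>S\<close>
    as \<open>C\<close>.\<close>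
  have X: "C \<union> T \<union> (path_image c - {a,b}) \<subseteq> inside S"
    if T: "connected T" "T \<inter> C \<noteq> {}" "T \<inter> path_image c \<noteq> {}" "T \<inter> S = {}" and S: "{a,b} \<subseteq> S"
      and c: "arc c" "pathstart c = a" "pathfinish c = b" "(path_image c - {a,b}) \<inter> S = {}"
      and C: "connected C" "C \<inter> S = {}"
      and meet: "(C \<union> (path_image c - {a,b})) \<inter> inside S \<noteq> {}" for T c S
  proof (rule connected_subset_inside)
    have "connected (path_image c - {a,b})"
      using connected_simple_path_endless [OF arc_imp_simple_path [OF c(1)]] c by simp
    then show "connected (C \<union> T \<union> (path_image c - {a,b}))"
      using T S C by (intro connected_Un) blast+
    show "(C \<union> T \<union> (path_image c - {a, b})) \<inter> S = {}" using T C c by blast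
    show "(C \<union> T \<union> (path_image c - {a, b})) \<inter> inside S \<noteq> {}" using meet by blast
  qed
  let ?A = "path_image c1 \<union> path_image c2" and ?B = "path_image c2 \<union> path_image c3"
    and ?D = "path_image c1 \<union> path_image c3"
  have ab: "a \<noteq> b" using c1 arc_distinct_ends by metis
  have abin: "{a,b} \<subseteq> ?A" "{a,b} \<subseteq> ?B" "{a,b} \<subseteq> ?D" using c12 c23 by blast+
  have "(path_image c3 - {a,b}) \<inter> inside ?A \<noteq> {}"
    using ins abin inside_no_overlap [of ?A] by blast
  then have CA: "C \<subseteq> inside ?A"
    using X [OF T3 abin(1) c3 _ C(1)] c13 c23 C(2) by blast
  \<comment> \<open>\<open>c3\<close> divides the inside of \<open>c1\<close> and \<open>c2\<close>
    in two. Whichever half contains \<open>C\<close>, the arc not bounding that half is dragged into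
    it, although it bounds the undivided region.\<close>
  obtain split: "inside ?D \<inter> inside ?B = {}"
    "inside ?D \<union> inside ?B \<union> (path_image c3 - {a,b}) = inside ?A"
    using split_inside_simple_closed_curve [of c1 a b c2 c3] c1 c2 c3 c12 c13 c23 ab ins
    by (metis arc_imp_simple_path)
  obtain x where x: "x \<in> C" using T1 by blast
  then consider "x \<in> inside ?D" | "x \<in> inside ?B" using CA split C by blast
  then show False
  proof cases
    case 1
    then have "path_image c2 - {a,b} \<subseteq> inside ?D"
      using X [OF T2 abin(3) c2 _ C(1)] c12 c23 C(2) x by blast
    then have "path_image c2 - {a,b} \<subseteq> inside ?A" using split by blast
    moreover obtain y where "y \<in> path_image c2" "y \<noteq> a" "y \<noteq> b"
      using arc_interior_nonempty [OF c2] by blast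
    ultimately show False using inside_no_overlap [of ?A] by blast
  next
    case 2
    then have "path_image c1 - {a,b} \<subseteq> inside ?B"
      using X [OF T1 abin(2) c1 _ C(1)] c12 c13 C(2) x by blast
    then have "path_image c1 - {a,b} \<subseteq> inside ?A" using split by blast
    moreover obtain y where "y \<in> path_image c1" "y \<noteq> a" "y \<noteq> b"
      using arc_interior_nonempty [OF c1] by blast
    ultimately show False using inside_no_overlap [of ?A] by blast
  qed
qed

lemma no_common_neighbour:
  assumes C: "connected C" "C \<inter> (path_image c1 \<union> path_image c2 \<union> path_image c3) = {}"
    and T1: "connected T1" "T1 \<inter> C \<noteq> {}" "T1 \<inter> path_image c1 \<noteq> {}" "T1 \<inter> (path_image c2 \<union> path_image c3) = {}"
    and T2: "connected T2" "T2 \<inter> C \<noteq> {}" "T2 \<inter> path_image c2 \<noteq> {}" "T2 \<inter> (path_image c1 \<union> path_image c3) = {}"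
    and T3: "connected T3" "T3 \<inter> C \<noteq> {}" "T3 \<inter> path_image c3 \<noteq> {}" "T3 \<inter> (path_image c1 \<union> path_image c2) = {}"
  shows False
  using some_arc_inside
proof (elim disjE)
  assume "path_image c3 \<inter> inside (path_image c1 \<union> path_image c2) \<noteq> {}"
  then show False using no_common_neighbour_aux [OF C T1 T2 T3] by blast
next
  assume "path_image c1 \<inter> inside (path_image c2 \<union> path_image c3) \<noteq> {}"
  then show False
    using theta_curve.no_common_neighbour_aux [OF rotate, of C T2 T3 T1] C T1 T2 T3
    by (simp add: Un_ac)
next
  assume ins: "path_image c2 \<inter> inside (path_image c1 \<union> path_image c3) \<noteq> {}"
  show False
    by (rule theta_curve.no_common_neighbour_aux [OF theta_curve.rotate [OF rotate], of C T3 T1 T2])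
       (use C T1 T2 T3 ins in \<open>simp_all add: Un_ac\<close>)
qed

end

section \<open>Complementary components of locally connected closed sets\<close>

text \<open>A path is cut where it first enters the disc about \<open>b\<close> and then, run
  backwards, where it first enters the disc about \<open>a\<close>; passing to an arc keeps the two
  end points.\<close>

lemma crossing_subarc:
  fixes a b :: complex
  assumes U: "open U" "connected U" and u: "u \<in> U" "u \<in> cball a r" and v: "v \<in> U" "v \<in> cball b r"
    and ab: "cball a r \<inter> cball b r = {}"
  obtains p i j where "arc p" "pathstart p = i" "pathfinish p = j" "path_image p \<subseteq> U"
    "path_image p \<inter> cball a r = {i}" "path_image p \<inter> cball b r = {j}" "dist a i = r" "dist b j = r"
proof -
  obtain g where g: "path g" "path_image g \<subseteq> U" "pathstart g = u" "pathfinish g = v"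
    using connected_open_path_connected [OF U] u v unfolding path_connected_def by blast
  have "pathstart g \<in> closure (- cball b r)" "pathfinish g \<notin> - cball b r"
    using g u v ab closure_subset [of "- cball b r"] by auto
  then obtain h where h: "path h" "pathstart h = u" "path_image h \<subseteq> path_image g"
      "path_image h - {pathfinish h} \<subseteq> interior (- cball b r)" "pathfinish h \<in> frontier (- cball b r)"
    using exists_path_subpath_to_frontier [OF g(1)] g(3) by metis
  have hb: "path_image h - {pathfinish h} \<subseteq> - cball b r" using h(4) interior_subset by blast
  have bh: "dist b (pathfinish h) = r" using h(5) by simp
  let ?h = "reversepath h"
  have "pathstart ?h \<in> closure (- cball a r)" "pathfinish ?h \<notin> - cball a r"
    using h u bh ab closure_subset [of "- cball a r"] by auto
  then obtain k where k: "path k" "pathstart k = pathfinish h" "path_image k \<subseteq> path_image h"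
      "path_image k - {pathfinish k} \<subseteq> interior (- cball a r)" "pathfinish k \<in> frontier (- cball a r)"
    using exists_path_subpath_to_frontier [of ?h "- cball a r"] h(1) by auto
  have ka: "path_image k - {pathfinish k} \<subseteq> - cball a r" using k(4) interior_subset by blast
  have ak: "dist a (pathfinish k) = r" using k(5) by simp
  have "pathfinish k \<noteq> pathstart k" using ab ak bh k(2) by auto
  then obtain q where q: "arc q" "path_image q \<subseteq> path_image k" "pathstart q = pathfinish k" "pathfinish q = pathstart k"
    using path_contains_arc [of "reversepath k" "pathfinish k" "pathstart k"] k(1) by auto
  have ends: "pathfinish k \<in> path_image q" "pathfinish h \<in> path_image q"
    using q k(2) pathstart_in_path_image [of q] pathfinish_in_path_image [of q] by auto
  show thesis
  proof (rule that [of q "pathfinish k" "pathfinish h"])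
    show "path_image q \<inter> cball a r = {pathfinish k}" using ends ak q(2) ka by auto
    show "path_image q \<inter> cball b r = {pathfinish h}" using ends bh q(2) k(3) hb by auto
  qed (use q k(2,3) h(3) g(2) ak bh in auto)
qed

lemma segments_from_common_centre:
  fixes a :: "'a::real_normed_vector"
  assumes "r > 0" "dist a i = r" "dist a j = r" "x \<in> closed_segment a i" "x \<in> closed_segment a j"
  shows "x = a \<or> i = j"
proof -
  obtain s where s: "0 \<le> s" "x = a + s *\<^sub>R (i - a)"
    using assms by (auto simp: in_segment algebra_simps)
  obtain t where t: "0 \<le> t" "x = a + t *\<^sub>R (j - a)"
    using assms by (auto simp: in_segment algebra_simps)
  have "norm (s *\<^sub>R (i - a)) = norm (t *\<^sub>R (j - a))" using s t by simp
  then have "s * r = t * r" using s t assms by (simp add: dist_norm norm_minus_commute)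
  then have "s = t" using assms by simp
  with s t show ?thesis by (cases "t = 0") auto
qed

lemma spoke_arc:
  fixes a b :: complex
  assumes p: "arc p" "pathstart p = i" "pathfinish p = j"
    and ab: "cball a r \<inter> cball b r = {}" and r: "r > 0"
    and pa: "path_image p \<inter> cball a r = {i}" and pb: "path_image p \<inter> cball b r = {j}"
    and ij: "dist a i = r" "dist b j = r"
  defines "c \<equiv> linepath a i +++ (p +++ linepath j b)"
  shows "arc c" "pathstart c = a" "pathfinish c = b"
    "path_image c = closed_segment a i \<union> path_image p \<union> closed_segment j b"
    "closed_segment a i \<subseteq> cball a r" "closed_segment j b \<subseteq> cball b r"
proof -
  show sa: "closed_segment a i \<subseteq> cball a r"
    using ij r by (intro closed_segment_subset) auto
  show sb: "closed_segment j b \<subseteq> cball b r"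
    using ij r by (intro closed_segment_subset) auto
  have 1: "arc (p +++ linepath j b)"
  proof (rule arc_join)
    show "arc (linepath j b)" using ij r by (intro arc_linepath) auto
    show "path_image p \<inter> path_image (linepath j b) \<subseteq> {pathstart (linepath j b)}"
      using sb pb by auto
  qed (use p in auto)
  show "arc c"
    unfolding c_def
  proof (rule arc_join [OF _ 1])
    show "arc (linepath a i)" using ij r by (intro arc_linepath) auto
    have "path_image (p +++ linepath j b) = path_image p \<union> closed_segment j b"
      using p by (simp add: path_image_join)
    then show "path_image (linepath a i) \<inter> path_image (p +++ linepath j b) \<subseteq> {pathstart (p +++ linepath j b)}"
      using sa sb pa ab p by auto
  qed (use p in auto)
  show "pathstart c = a" "pathfinish c = b" by (auto simp: c_def)
  show "path_image c = closed_segment a i \<union> path_image p \<union> closed_segment j b"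
    using p by (simp add: c_def path_image_join Un_assoc)
qed

text \<open>The distinct components \<open>U k\<close> contain arcs from near \<open>a\<close> to near \<open>b\<close>, prolonged by radii to arcs \<open>c k\<close> from
  \<open>a\<close> to \<open>b\<close>; local connectedness at a limit \<open>q\<close> of points halfway between \<open>a\<close> and \<open>b\<close> yields the connected
  set \<open>C\<close> adjacent to three of them.\<close>

theorem locally_connected_no_crossing_accumulation:
  fixes J :: "complex set" and U :: "nat \<Rightarrow> complex set"
  assumes J: "closed J" "locally connected J"
    and U: "\<And>k. U k \<in> components (- J)" and inj: "inj U"
    and s: "\<And>k. s k \<in> U k" "s \<longlonglongrightarrow> a" and t: "\<And>k. t k \<in> U k" "t \<longlonglongrightarrow> b"
  shows "a = b"
proof (rule ccontr)
  assume "a \<noteq> b"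
  \<comment> \<open>In units of \<open>r\<close>, the discs about \<open>a\<close> and
    \<open>b\<close> have radius 2, the arcs run from distance 2 to distance at least 6 from
    \<open>a\<close>, and the halfway points lie at distance 4. A disc of radius 1 about such a
    point misses both discs, hence the radii in them.\<close>
  define r where "r = dist a b / 8"
  have r: "r > 0" "dist a b = 8 * r" using \<open>a \<noteq> b\<close> by (auto simp: r_def)
  have disj: "cball a (2*r) \<inter> cball b (2*r) = {}"
  proof -
    have False if "dist a x \<le> 2*r" "dist b x \<le> 2*r" for x
      using dist_triangle [of a b x] that r by (simp add: dist_commute)
    then show ?thesis by (auto simp: mem_cball)
  qed
  have oU: "open (U k)" "connected (U k)" "U k \<inter> J = {}" for k
    using U [of k] J(1) open_components in_components_connected in_components_subset by (blast intro: open_Compl)+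
  have Udisj: "U k \<inter> U l = {}" if "k \<noteq> l" for k l
    using components_nonoverlap [OF U U, of k l] inj that by (auto simp: inj_def)
  have "\<forall>\<^sub>F k in sequentially. dist (s k) a < 2*r" "\<forall>\<^sub>F k in sequentially. dist (t k) b < 2*r"
    using s(2) t(2) r by (auto intro: tendstoD)
  then have "\<forall>\<^sub>F k in sequentially. dist (s k) a < 2*r \<and> dist (t k) b < 2*r" by (rule eventually_conj)
  then obtain N where N: "\<And>k. k \<ge> N \<Longrightarrow> dist (s k) a < 2*r \<and> dist (t k) b < 2*r"
    unfolding eventually_sequentially by blast
  have "\<forall>k. \<exists>p. arc p \<and> path_image p \<subseteq> U (k + N) \<and>
      path_image p \<inter> cball a (2*r) = {pathstart p} \<and> path_image p \<inter> cball b (2*r) = {pathfinish p} \<and>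
      dist a (pathstart p) = 2*r \<and> dist b (pathfinish p) = 2*r"
  proof
    fix k
    have st: "s (k + N) \<in> cball a (2*r)" "t (k + N) \<in> cball b (2*r)"
      using N [of "k + N"] by (auto simp: dist_commute)
    show "\<exists>p. arc p \<and> path_image p \<subseteq> U (k + N) \<and>
      path_image p \<inter> cball a (2*r) = {pathstart p} \<and> path_image p \<inter> cball b (2*r) = {pathfinish p} \<and>
      dist a (pathstart p) = 2*r \<and> dist b (pathfinish p) = 2*r"
      by (rule crossing_subarc [OF oU(1,2) s(1) st(1) t(1) st(2) disj]) metis
  qed
  then obtain p where p': "\<forall>k. arc (p k) \<and> path_image (p k) \<subseteq> U (k + N) \<and>
      path_image (p k) \<inter> cball a (2*r) = {pathstart (p k)} \<and>
      path_image (p k) \<inter> cball b (2*r) = {pathfinish (p k)} \<and>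
      dist a (pathstart (p k)) = 2*r \<and> dist b (pathfinish (p k)) = 2*r"
    by (rule choice [THEN exE])
  define i j where "i = (\<lambda>k. pathstart (p k))" and "j = (\<lambda>k. pathfinish (p k))"
  have p: "\<And>k. arc (p k)" "\<And>k. pathstart (p k) = i k" "\<And>k. pathfinish (p k) = j k"
      "\<And>k. path_image (p k) \<subseteq> U (k + N)"
      "\<And>k. path_image (p k) \<inter> cball a (2*r) = {i k}" "\<And>k. path_image (p k) \<inter> cball b (2*r) = {j k}"
      "\<And>k. dist a (i k) = 2*r" "\<And>k. dist b (j k) = 2*r"
    using p' by (auto simp: i_def j_def)
  have r2: "2*r > 0" using r by simp
  define c where "c = (\<lambda>k. linepath a (i k) +++ (p k +++ linepath (j k) b))"
  note sp = spoke_arc [OF p(1) p(2) p(3) disj r2 p(5) p(6) p(7) p(8)]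
  have c: "arc (c k)" "pathstart (c k) = a" "pathfinish (c k) = b"
    "path_image (c k) = closed_segment a (i k) \<union> path_image (p k) \<union> closed_segment (j k) b" for k
    using sp [of k] by (auto simp: c_def)
  have cc: "path_image (c k) \<inter> path_image (c l) = {a,b}" if "k \<noteq> l" for k l
  proof -
    have pp: "path_image (p k) \<inter> path_image (p l) = {}"
      using p(4) [of k] p(4) [of l] Udisj [of "k + N" "l + N"] that by auto
    have "i k \<noteq> i l" "j k \<noteq> j l" using pp p(5,6) [of k] p(5,6) [of l] by blast+
    then have seg: "closed_segment a (i k) \<inter> closed_segment a (i l) \<subseteq> {a}"
        "closed_segment (j k) b \<inter> closed_segment (j l) b \<subseteq> {b}"
      using segments_from_common_centre [OF r2 p(7) [of k] p(7) [of l]]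
        segments_from_common_centre [OF r2 p(8) [of k] p(8) [of l]]
      by (auto simp: closed_segment_commute)
    have *: "S \<inter> P = {}" if "S \<subseteq> K" "P \<inter> K = {x}" "x \<notin> S" for S P K :: "complex set" and x
      using that(1,3) equalityD1 [OF that(2)] by blast
    have ni: "i k \<notin> closed_segment a (i l)" "i l \<notin> closed_segment a (i k)"
      using seg(1) p(7) [of k] p(7) [of l] r2 by auto
    have nj: "j k \<notin> closed_segment (j l) b" "j l \<notin> closed_segment (j k) b"
      using seg(2) p(8) [of k] p(8) [of l] r2 by auto
    have off: "closed_segment a (i k) \<inter> path_image (p l) = {}" "closed_segment a (i l) \<inter> path_image (p k) = {}"
        "closed_segment (j k) b \<inter> path_image (p l) = {}" "closed_segment (j l) b \<inter> path_image (p k) = {}"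
      by (rule * [OF sp(5) p(5)] * [OF sp(6) p(6)], rule ni nj)+
    have ab: "closed_segment a (i k) \<inter> closed_segment (j l) b = {}" "closed_segment a (i l) \<inter> closed_segment (j k) b = {}"
      using sp(5,6) [of k] sp(5,6) [of l] disj by blast+
    have **: "(A \<union> P \<union> B) \<inter> (A' \<union> P' \<union> B') \<subseteq> {a,b}"
      if "A \<inter> A' \<subseteq> {a}" "B \<inter> B' \<subseteq> {b}" "P \<inter> P' = {}" "A \<inter> P' = {}" "A' \<inter> P = {}"
        "B \<inter> P' = {}" "B' \<inter> P = {}" "A \<inter> B' = {}" "A' \<inter> B = {}" for A A' B B' P P' :: "complex set"
      using that unfolding disjoint_iff subset_iff by auto
    have "path_image (c k) \<inter> path_image (c l) \<subseteq> {a,b}"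
      unfolding c(4) by (rule ** [OF seg pp off ab])
    moreover have "{a,b} \<subseteq> path_image (c k) \<inter> path_image (c l)" unfolding c(4) by auto
    ultimately show ?thesis by blast
  qed
  have "\<exists>u\<in>path_image (p k). dist a u = 4*r" for k
  proof -
    have "connected ((\<lambda>u. dist a u) ` path_image (p k))"
      using p(1) by (intro connected_continuous_image continuous_intros connected_arc_image)
    moreover have "2*r \<in> (\<lambda>u. dist a u) ` path_image (p k)" using p(5,7) [of k] by (metis IntD1 image_eqI insertI1)
    moreover have "dist a (j k) \<in> (\<lambda>u. dist a u) ` path_image (p k)" using p(6) [of k] by blast
    moreover have "dist a (j k) \<ge> 6*r" using dist_triangle [of a b "j k"] p(8) [of k] r by (simp add: dist_commute)
    ultimately have "4*r \<in> (\<lambda>u. dist a u) ` path_image (p k)"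
      using r unfolding is_interval_connected_1 [symmetric] is_interval_1
      by (smt (verit))
    then show ?thesis by force
  qed
  then obtain u where u: "\<And>k. u k \<in> path_image (p k)" "\<And>k. dist a (u k) = 4*r" by metis
  have uU: "u k \<in> U (k + N)" for k using u(1) p(4) by blast
  have "\<forall>k. u k \<in> sphere a (4*r)" using u(2) by simp
  then obtain q \<sigma> where q: "q \<in> sphere a (4*r)" "strict_mono (\<sigma> :: nat \<Rightarrow> nat)" "(u \<circ> \<sigma>) \<longlonglongrightarrow> q"
    using compact_sphere [of a "4*r"] unfolding compact_def by metis
  have near: "\<exists>k\<ge>K. u (\<sigma> k) \<in> S" if "open S" "q \<in> S" for S K
  proof -
    have "\<forall>\<^sub>F k in sequentially. (u \<circ> \<sigma>) k \<in> S" by (rule topological_tendstoD [OF q(3) that])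
    then obtain K' where "\<And>k. k \<ge> K' \<Longrightarrow> u (\<sigma> k) \<in> S" unfolding eventually_sequentially by auto
    then show ?thesis by (intro exI [of _ "max K K'"]) auto
  qed
  \<comment> \<open>Otherwise the component containing \<open>q\<close> would contain points
    \<open>u\<close> of two different indices.\<close>
  have qJ: "q \<in> J"
  proof (rule ccontr)
    assume "q \<notin> J"
    then have "q \<in> \<Union> (components (- J))" by simp
    then obtain S where S: "S \<in> components (- J)" "q \<in> S" by blast
    have "open S" using S J(1) open_components open_Compl by blast
    obtain k where k: "u (\<sigma> k) \<in> S" using near [OF \<open>open S\<close> S(2)] by blast
    obtain l where l: "l \<ge> Suc k" "u (\<sigma> l) \<in> S" using near [OF \<open>open S\<close> S(2)] by blast
    have "S = U (\<sigma> k + N)" using components_nonoverlap [OF S(1) U [of "\<sigma> k + N"]] k uU by blast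
    moreover have "S = U (\<sigma> l + N)" using components_nonoverlap [OF S(1) U [of "\<sigma> l + N"]] l uU by blast
    ultimately have "\<sigma> k + N = \<sigma> l + N" using inj by (metis injD)
    then have "\<sigma> k = \<sigma> l" by simp
    then show False using l(1) q(2) strict_mono_less [of \<sigma> k l] by auto
  qed
  obtain W C where W: "open W" "q \<in> W" "J \<inter> W \<subseteq> C" and C: "connected C" "C \<subseteq> J \<inter> ball q r"
    using locally_connectedE [OF J(2) qJ, of "ball q r"] r by auto
  have "open (W \<inter> ball q r)" "q \<in> W \<inter> ball q r" using W r by auto
  then obtain \<delta> where \<delta>: "\<delta> > 0" "ball q \<delta> \<subseteq> W \<inter> ball q r" using openE by metis
  have away: "x \<notin> cball a (2*r)" "x \<notin> cball b (2*r)" if "x \<in> ball q r" for x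
  proof -
    have "dist q x < r" "dist a q = 4*r" using that q(1) by auto
    then show "x \<notin> cball a (2*r)" "x \<notin> cball b (2*r)"
      using dist_triangle [of a q x] dist_triangle [of a x q] dist_triangle [of a b x] r
      by (auto simp: dist_commute)
  qed
  have qd: "q \<in> ball q \<delta>" using \<delta> by simp
  obtain k1 where k1: "u (\<sigma> k1) \<in> ball q \<delta>" using near [OF open_ball qd] by blast
  obtain k2 where k2: "k2 \<ge> Suc k1" "u (\<sigma> k2) \<in> ball q \<delta>" using near [OF open_ball qd] by blast
  obtain k3 where k3: "k3 \<ge> Suc k2" "u (\<sigma> k3) \<in> ball q \<delta>" using near [OF open_ball qd] by blast
  have ne: "\<sigma> k1 \<noteq> \<sigma> k2" "\<sigma> k1 \<noteq> \<sigma> k3" "\<sigma> k2 \<noteq> \<sigma> k3"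
    using q(2) k2 k3 by (simp_all add: strict_mono_eq)
  have CU: "C \<inter> path_image (c k) = {}" for k
  proof -
    have "x \<notin> path_image (c k)" if "x \<in> C" for x
      using that C(2) away [of x] sp(5,6) [of k] p(4) [of k] oU(3) [of "k + N"]
      unfolding c(4) by (auto simp: disjoint_iff subset_iff)
    then show ?thesis by blast
  qed
  have T: "\<exists>T. connected T \<and> T \<inter> C \<noteq> {} \<and> T \<inter> path_image (c k) \<noteq> {} \<and> (\<forall>l'. l' \<noteq> k \<longrightarrow> T \<inter> path_image (c l') = {})"
    if kl: "k \<noteq> l" "u k \<in> ball q \<delta>" "u l \<in> ball q \<delta>" for k l
  proof -
    have "u l \<notin> U (k + N)" using uU [of l] Udisj [of "l + N" "k + N"] kl by auto
    \<comment> \<open>The segment from \<open>u k\<close> to \<open>u l\<close> is followed until it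
      leaves \<open>U (k + N)\<close>. The exit point is in \<open>J\<close>, hence in
      \<open>C\<close>, and up to it no other component is met.\<close>
    then obtain h where h: "path h" "pathstart h = u k" "path_image h \<subseteq> closed_segment (u k) (u l)"
        "path_image h - {pathfinish h} \<subseteq> interior (U (k + N))" "pathfinish h \<in> frontier (U (k + N))"
      using exists_path_subpath_to_frontier [of "linepath (u k) (u l)" "U (k + N)"] uU [of k]
        closure_subset [of "U (k + N)"] by (auto simp: subset_iff)
    have hb: "path_image h \<subseteq> ball q \<delta>"
      using h(3) closed_segment_subset [OF kl(2,3) convex_ball] by blast
    have hJ: "pathfinish h \<in> J"
      using h(5) frontier_of_components_closed_complement [OF J(1) U] by blast
    have fin: "pathfinish h \<in> path_image h" "u k \<in> path_image h"
      using h(2) pathfinish_in_path_image [of h] pathstart_in_path_image [of h] by auto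
    have "pathfinish h \<in> C" using hJ fin(1) hb \<delta> W by blast
    moreover have "u k \<in> path_image (c k)" unfolding c(4) using u(1) by blast
    moreover have "path_image h \<inter> path_image (c l') = {}" if "l' \<noteq> k" for l'
    proof -
      have "path_image h \<inter> U (l' + N) = {}"
      proof -
        have "path_image h \<subseteq> insert (pathfinish h) (U (k + N))"
          using h(4) interior_subset [of "U (k + N)"] by blast
        moreover have "U (k + N) \<inter> U (l' + N) = {}" using Udisj [of "k + N" "l' + N"] that by simp
        ultimately show ?thesis using hJ oU(3) [of "l' + N"] by blast
      qed
      moreover have "path_image h \<subseteq> ball q r" using hb \<delta> by blast
      moreover have "x \<notin> path_image (c l')" if "x \<in> ball q r" "x \<notin> U (l' + N)" for x
        using that away [of x] sp(5,6) [of l'] p(4) [of l'] unfolding c(4) by (auto simp: subset_iff)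
      ultimately show ?thesis by blast
    qed
    ultimately show ?thesis
      using h(1) fin by (intro exI [of _ "path_image h"]) (auto simp: connected_path_image)
  qed
  obtain T1 where T1: "connected T1" "T1 \<inter> C \<noteq> {}" "T1 \<inter> path_image (c (\<sigma> k1)) \<noteq> {}"
      "T1 \<inter> path_image (c (\<sigma> k2)) = {}" "T1 \<inter> path_image (c (\<sigma> k3)) = {}"
    using T [OF ne(1) k1 k2(2)] ne by metis
  obtain T2 where T2: "connected T2" "T2 \<inter> C \<noteq> {}" "T2 \<inter> path_image (c (\<sigma> k2)) \<noteq> {}"
      "T2 \<inter> path_image (c (\<sigma> k1)) = {}" "T2 \<inter> path_image (c (\<sigma> k3)) = {}"
    using T [OF ne(3) k2(2) k3(2)] ne by metis
  obtain T3 where T3: "connected T3" "T3 \<inter> C \<noteq> {}" "T3 \<inter> path_image (c (\<sigma> k3)) \<noteq> {}"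
      "T3 \<inter> path_image (c (\<sigma> k1)) = {}" "T3 \<inter> path_image (c (\<sigma> k2)) = {}"
    using T [OF ne(2) [symmetric] k3(2) k1] ne by metis
  interpret theta_curve "c (\<sigma> k1)" "c (\<sigma> k2)" "c (\<sigma> k3)" a b
    by (rule theta_curve.intro) (rule c cc ne)+
  show False
    by (rule no_common_neighbour [of C T1 T2 T3])
       (simp_all add: C(1) CU T1 T2 T3 Int_Un_distrib)
qed

text \<open>Infinitely many such components would contain points of the disc and points of modulus
  \<open>R + 1\<close> that converge along a common subsequence; the two limits cannot
  agree.\<close>

corollary finitely_many_crossing_components:
  fixes J :: "complex set"
  assumes J: "closed J" "locally connected J"
  shows "finite {U \<in> components (- J). U \<inter> cball 0 R \<noteq> {} \<and> \<not> U \<subseteq> ball 0 (R + 1)}"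
proof (rule ccontr)
  let ?\<U> = "{U \<in> components (- J). U \<inter> cball 0 R \<noteq> {} \<and> \<not> U \<subseteq> ball 0 (R + 1)}"
  assume "infinite ?\<U>"
  then obtain U :: "nat \<Rightarrow> complex set" where U: "inj U" "range U \<subseteq> ?\<U>"
    using infinite_countable_subset by blast
  then have UC: "\<And>k. U k \<in> components (- J)" by blast
  have "\<exists>z\<in>U k. norm z = R + 1" for k
  proof -
    obtain x y where xy: "x \<in> U k" "norm x \<le> R" "y \<in> U k" "norm y \<ge> R + 1"
      using U(2) by (force simp: not_less)
    have "connected (norm ` U k)"
      using UC by (intro connected_continuous_image continuous_intros) (rule in_components_connected)
    then have "R + 1 \<in> norm ` U k"
      using xy unfolding is_interval_connected_1 [symmetric] is_interval_1 by (smt (verit) image_eqI)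
    then show ?thesis by force
  qed
  then obtain t where t: "\<And>k. t k \<in> U k" "\<And>k. norm (t k) = R + 1" by metis
  have "\<exists>z\<in>U k. norm z \<le> R" for k using U(2) by fastforce
  then obtain s where s: "\<And>k. s k \<in> U k" "\<And>k. norm (s k) \<le> R" by metis
  have cpt: "compact (cball (0::complex) R \<times> sphere (0::complex) (R + 1))" by (intro compact_Times) auto
  have "\<forall>k. (s k, t k) \<in> cball 0 R \<times> sphere 0 (R + 1)" using s t by auto
  then obtain l \<sigma> where l: "l \<in> cball 0 R \<times> sphere 0 (R + 1)" "strict_mono (\<sigma> :: nat \<Rightarrow> nat)"
      "((\<lambda>k. (s k, t k)) \<circ> \<sigma>) \<longlonglongrightarrow> l"
    by (rule seq_compactE [OF cpt [unfolded compact_eq_seq_compact_metric]])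
  have "(\<lambda>k. s (\<sigma> k)) \<longlonglongrightarrow> fst l" "(\<lambda>k. t (\<sigma> k)) \<longlonglongrightarrow> snd l"
    using tendsto_fst [OF l(3)] tendsto_snd [OF l(3)] by (simp_all add: o_def)
  moreover have "inj (\<lambda>k. U (\<sigma> k))"
    using inj_compose [OF U(1) strict_mono_imp_inj_on [OF l(2)]] by (simp add: o_def)
  ultimately have "fst l = snd l"
    using locally_connected_no_crossing_accumulation [OF J, of "\<lambda>k. U (\<sigma> k)" "\<lambda>k. s (\<sigma> k)" _ "\<lambda>k. t (\<sigma> k)"]
      UC s(1) t(1) by blast
  then show False using l(1) by auto
qed

section \<open>Lifting rays; unbounded Fatou components\<close>

text \<open>Critical points are allowed: near \<open>v\<close> the function \<open>g - p\<close> is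
  the \<open>n\<close>th power of a local coordinate \<open>\<phi>\<close>, so the lift is the
  inverse of \<open>\<phi>\<close> applied to an \<open>n\<close>th root of the ray.\<close>

lemma lift_ray:
  assumes g: "g holomorphic_on UNIV" "\<not> g constant_on UNIV" and v: "g v = p"
  obtains \<epsilon> h where "\<epsilon> > 0" "continuous_on {0..\<epsilon>} h" "h 0 = v"
    "\<And>s. s \<in> {0..\<epsilon>} \<Longrightarrow> g (h s) = p + of_real s * d"
proof -
  have gp: "(\<lambda>z. g z - p) holomorphic_on UNIV" using g by (intro holomorphic_intros)
  have gn: "\<not> (\<lambda>z. g z - p) constant_on UNIV"
  proof
    assume "(\<lambda>z. g z - p) constant_on UNIV"
    then obtain c where "\<And>z. g z - p = c" unfolding constant_on_def by blast
    then have "g z = c + p" for z by (metis diff_add_cancel)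
    then show False using g(2) unfolding constant_on_def by blast
  qed
  obtain k r n where n: "0 < (n::nat)" and r: "0 < r" and k: "k holomorphic_on ball v r"
      "\<And>w. w \<in> ball v r \<Longrightarrow> g w - p = (w - v) ^ n * k w" "\<And>w. w \<in> ball v r \<Longrightarrow> k w \<noteq> 0"
  proof (rule holomorphic_factor_zero_nonconstant [OF gp open_UNIV connected_UNIV UNIV_I _ gn, of v])
    show "g v - p = 0" using v by simp
  qed blast
  obtain l where l: "l holomorphic_on ball v r" "\<And>w. w \<in> ball v r \<Longrightarrow> k w = exp (l w)"
    using contractible_imp_holomorphic_log [OF k(1) convex_imp_contractible [OF convex_ball] k(3)] by blast
  define \<phi> where "\<phi> = (\<lambda>w. (w - v) * exp (l w / of_nat n))"
  have \<phi>n: "g w - p = \<phi> w ^ n" if "w \<in> ball v r" for w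
    using k(2) [OF that] l(2) [OF that] n
    by (simp add: \<phi>_def power_mult_distrib exp_of_nat_mult [symmetric])
  have \<phi>: "\<phi> holomorphic_on ball v r"
    unfolding \<phi>_def using n by (intro holomorphic_intros l) auto
  have vin: "v \<in> ball v r" using r by simp
  have "(l has_field_derivative deriv l v) (at v)"
    using l(1) vin holomorphic_derivI by blast
  then have "(\<phi> has_field_derivative exp (l v / of_nat n)) (at v)"
    unfolding \<phi>_def using n by (auto intro!: derivative_eq_intros)
  then have "deriv \<phi> v \<noteq> 0" by (simp add: DERIV_imp_deriv)
  then obtain \<rho> where \<rho>: "\<rho> > 0" "ball v \<rho> \<subseteq> ball v r" "open (\<phi> ` ball v \<rho>)" "inj_on \<phi> (ball v \<rho>)"
    using has_complex_derivative_locally_invertible [OF \<phi> vin open_ball] by blast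
  obtain \<psi> where \<psi>: "\<psi> holomorphic_on \<phi> ` ball v \<rho>" "\<And>z. z \<in> ball v \<rho> \<Longrightarrow> \<psi> (\<phi> z) = z"
    using holomorphic_has_inverse [OF holomorphic_on_subset [OF \<phi> \<rho>(2)] open_ball \<rho>(4)] by metis
  have \<phi>v: "\<phi> v = 0" by (simp add: \<phi>_def)
  have "0 \<in> \<phi> ` ball v \<rho>" using \<phi>v \<rho>(1) by (metis centre_in_ball image_eqI)
  then obtain \<delta> where \<delta>: "\<delta> > 0" "ball 0 \<delta> \<subseteq> \<phi> ` ball v \<rho>" using \<rho>(3) openE by blast
  obtain \<omega> where \<omega>: "d = \<omega> ^ n" using exists_complex_root [of n d] n by auto
  \<comment> \<open>The summand 1 keeps the denominator positive when \<open>\<omega>\<close> is 0,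
    and makes the estimate below strict.\<close>
  define \<eta> where "\<eta> = \<delta> / (norm \<omega> + 1)"
  have \<eta>: "\<eta> > 0" using \<delta> by (simp add: \<eta>_def add_nonneg_pos)
  let ?y = "\<lambda>s. of_real (root n s) * \<omega>"
  have small: "?y s \<in> ball 0 \<delta>" if "s \<in> {0..\<eta> ^ n}" for s
  proof -
    have "root n s \<le> root n (\<eta> ^ n)" using that n by simp
    then have "root n s \<le> \<eta>" using n \<eta> by (simp add: real_root_power_cancel)
    moreover have "0 \<le> root n s" using that by (simp add: real_root_ge_zero)
    ultimately have "norm (?y s) \<le> \<eta> * norm \<omega>" by (simp add: norm_mult mult_right_mono)
    also have "\<dots> < \<eta> * (norm \<omega> + 1)" using \<eta> by simp
    also have "\<dots> = \<delta>"
    proof -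
      have "norm \<omega> + 1 \<noteq> 0" using norm_ge_zero [of \<omega>] by linarith
      then show ?thesis by (simp add: \<eta>_def)
    qed
    finally show ?thesis by simp
  qed
  show thesis
  proof (rule that [of "\<eta> ^ n" "\<lambda>s. \<psi> (?y s)"])
    show "\<eta> ^ n > 0" using \<eta> by simp
    have "continuous_on (\<phi> ` ball v \<rho>) \<psi>" using \<psi>(1) by (rule holomorphic_on_imp_continuous_on)
    moreover have "continuous_on {0..\<eta> ^ n} ?y" by (intro continuous_intros)
    ultimately show "continuous_on {0..\<eta> ^ n} (\<lambda>s. \<psi> (?y s))"
      by (rule continuous_on_compose2) (use small \<delta> in blast)
    show "\<psi> (?y 0) = v" using \<psi>(2) [of v] \<phi>v \<rho>(1) by simp
    fix s assume s: "s \<in> {0..\<eta> ^ n}"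
    then obtain w where w: "w \<in> ball v \<rho>" "?y s = \<phi> w" using small \<delta> by blast
    then have "g (\<psi> (?y s)) - p = ?y s ^ n" using \<psi>(2) \<phi>n \<rho>(2) by auto
    also have "\<dots> = of_real s * d"
      using s n by (simp add: \<omega> power_mult_distrib of_real_power [symmetric])
    finally show "g (\<psi> (?y s)) = p + of_real s * d" by (simp add: algebra_simps)
  qed
qed

context transcendental_map
begin

section \<open>Fatou components under iteration\<close>

lemma julia_Compl: "- julia_set f = fatou_set f"
  by (simp add: julia_set_def)

lemma fatou_iter_iff: "(f ^^ n) z \<in> fatou_set f \<longleftrightarrow> z \<in> fatou_set f"
  using julia_iter_iff [of n z] by (simp add: julia_set_def)

lemma frontier_fatou_component: "U \<in> components (fatou_set f) \<Longrightarrow> frontier U \<subseteq> julia_set f"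
  using frontier_of_components_closed_complement [OF closed_julia] by (simp add: julia_Compl)

lemma iterate_nonconstant: "\<not> (f ^^ n) constant_on UNIV"
proof
  assume "(f ^^ n) constant_on UNIV"
  then obtain c where "\<And>z. (f ^^ n) z = c" unfolding constant_on_def by blast
  then have "(f ^^ n) ` UNIV = {c}" by auto
  then show False using open_image_iter [OF open_UNIV, of n] not_open_singleton by metis
qed

lemma fatou_component_image_subset:
  assumes U: "U \<in> components (fatou_set f)" and V: "V \<in> components (fatou_set f)"
    and ne: "(f ^^ n) ` V \<inter> U \<noteq> {}"
  shows "(f ^^ n) ` V \<subseteq> U"
proof (rule components_maximal [OF U])
  show "connected ((f ^^ n) ` V)"
    using V cont_iter connected_continuous_image in_components_connected by blast
  show "(f ^^ n) ` V \<subseteq> fatou_set f"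
    using in_components_subset [OF V] by (auto simp: fatou_iter_iff)
qed (use ne in blast)

text \<open>If \<open>V\<close> were bounded, its frontier would go into the Julia set, so the image
  of \<open>V\<close> would be both open and closed in \<open>U\<close>, hence all of
  \<open>U\<close>, although it lies in a compact set.\<close>

lemma unbounded_fatou_preimage:
  assumes U: "U \<in> components (fatou_set f)" "\<not> bounded U" and V: "V \<in> components (fatou_set f)"
    and VU: "(f ^^ n) ` V \<subseteq> U"
  shows "\<not> bounded V"
proof
  assume b: "bounded V"
  let ?g = "f ^^ n"
  have oV: "open V" "V \<noteq> {}" using V open_fatou open_components in_components_nonempty by blast+
  have eq: "?g ` V = U \<inter> ?g ` closure V"
  proof
    show "?g ` V \<subseteq> U \<inter> ?g ` closure V" using VU closure_subset [of V] by blast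
    show "U \<inter> ?g ` closure V \<subseteq> ?g ` V"
    proof
      fix u assume u: "u \<in> U \<inter> ?g ` closure V"
      then obtain v where v: "v \<in> closure V" "u = ?g v" by blast
      have "u \<in> fatou_set f" using u in_components_subset [OF U(1)] by blast
      then have "v \<notin> julia_set f" using v fatou_iter_iff by (simp add: julia_set_def)
      then have "v \<notin> frontier V" using frontier_fatou_component [OF V] by blast
      then have "v \<in> V" using v oV by (simp add: frontier_def interior_open)
      then show "u \<in> ?g ` V" using v by blast
    qed
  qed
  have cpt: "compact (?g ` closure V)"
    using b by (intro compact_continuous_image cont_iter) simp
  have "openin (top_of_set U) (?g ` V)" using VU open_image_iter [OF oV(1)] by (simp add: open_openin_trans in_components_subset U open_subset)
  moreover have "closedin (top_of_set U) (?g ` V)"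
    unfolding eq using cpt by (simp add: closedin_closed_Int compact_imp_closed)
  ultimately have "?g ` V = U"
    using in_components_connected [OF U(1)] oV(2) unfolding connected_clopen by blast
  then have "U \<subseteq> ?g ` closure V" using eq by blast
  then show False using U(2) cpt compact_imp_bounded bounded_subset by blast
qed

text \<open>A compact Julia set could contain only finitely many preimages of a given Julia point,
  contrary to Picard's theorem.\<close>

lemma unbounded_julia: "\<not> bounded (julia_set f)"
proof
  assume b: "bounded (julia_set f)"
  obtain a where a: "\<And>w. w \<noteq> a \<Longrightarrow> infinite {z. f z = w}"
    using transcendental_Picard [OF transcendental] by blast
  obtain p where p: "p \<in> julia_set f" "p \<noteq> a" using julia_not_singleton [of a] by blast
  have "compact (julia_set f)" using b closed_julia compact_eq_bounded_closed by blast
  have nc: "\<not> (\<lambda>z. f z - p) constant_on UNIV"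
  proof
    assume "(\<lambda>z. f z - p) constant_on UNIV"
    then obtain c where "\<And>z. f z - p = c" unfolding constant_on_def by blast
    then have "f z = c + p" for z by (metis diff_add_cancel)
    then show False using not_constant_on [of UNIV] unfolding constant_on_def by blast
  qed
  have "finite {z \<in> julia_set f. f z - p = 0}"
    by (rule holomorphic_compact_finite_zeros [OF _ open_UNIV connected_UNIV \<open>compact _\<close> _ nc])
       (auto intro!: holomorphic_intros holo)
  moreover have "{z \<in> julia_set f. f z - p = 0} = {z. f z = p}" using p julia_iff by auto
  ultimately show False using a [OF p(2)] by simp
qed

end

lemma inside_disjoint_unbounded:
  assumes "connected U" "\<not> bounded U" "U \<inter> L = {}" "bounded L"
  shows "U \<subseteq> outside (L :: complex set)"
proof -
  have "U \<inter> inside L = {}"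
  proof (rule ccontr)
    assume "U \<inter> inside L \<noteq> {}"
    then obtain u where u: "u \<in> U" "u \<in> inside L" by blast
    have "U \<subseteq> connected_component_set (- L) u"
      using assms u by (intro connected_component_maximal) auto
    moreover have "bounded (connected_component_set (- L) u)" using u by (simp add: inside_def)
    ultimately show False using assms(2) bounded_subset by blast
  qed
  then show ?thesis using assms(3) unfolding outside_inside by blast
qed

lemma closure_outside_disjoint_inside:
  assumes "closed (L :: complex set)" "Q \<subseteq> outside L"
  shows "closure Q \<inter> inside L = {}"
  using assms open_inside [OF assms(1)] by (metis inf_commute inside_Int_outside open_Int_closure_eq_empty disjoint_iff subsetD)

context transcendental_map
begin

text \<open>The image of the cross-cut \<open>\<beta>\<close> is covered by a compact subset \<open>A\<close> of \<open>U\<close> and a segment \<open>B\<close> attached to it at one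
  point and ending at \<open>p\<close>. Neither separates points near the Julia set from infinity, and since
  \<open>A \<union> B\<close> meets the image of the continuum \<open>L\<close> in \<open>p\<close> only, Janiszewski's theorem applies twice.\<close>

lemma two_accesses_contradiction:
  assumes LC: "locally connected (julia_set f)"
    and U: "U \<in> components (fatou_set f)" "\<not> bounded U"
    and W: "W \<in> components (fatou_set f)" "(f ^^ n) ` W \<subseteq> U"
    and xy: "x \<noteq> y" "x \<in> julia_set f" "y \<in> julia_set f" "(f ^^ n) x = p" "(f ^^ n) y = p"
    and d: "d \<noteq> 0" and ray: "\<And>s. s \<in> {0<..\<epsilon>} \<Longrightarrow> p + of_real s * d \<in> U" and \<epsilon>: "\<epsilon> > 0"
    and hx: "continuous_on {0..\<epsilon>} hx" "hx 0 = x" "\<And>s. s \<in> {0..\<epsilon>} \<Longrightarrow> (f ^^ n) (hx s) = p + of_real s * d"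
      "\<And>s. s \<in> {0<..\<epsilon>} \<Longrightarrow> hx s \<in> W"
    and hy: "continuous_on {0..\<epsilon>} hy" "hy 0 = y" "\<And>s. s \<in> {0..\<epsilon>} \<Longrightarrow> (f ^^ n) (hy s) = p + of_real s * d"
      "\<And>s. s \<in> {0<..\<epsilon>} \<Longrightarrow> hy s \<in> W"
  shows False
proof -
  let ?J = "julia_set f" and ?g = "f ^^ n"
  have UW: "open U" "connected U" "open W" "connected W" "U \<inter> ?J = {}" "W \<inter> ?J = {}"
    using open_components [OF open_fatou U(1)] open_components [OF open_fatou W(1)]
      in_components_connected [OF U(1)] in_components_connected [OF W(1)]
      in_components_subset [OF U(1)] in_components_subset [OF W(1)]
    by (auto simp: julia_set_def)
  have Wub: "\<not> bounded W" by (rule unbounded_fatou_preimage [OF U W])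
  have pJ: "p \<in> ?J" using xy julia_iter_iff by metis
  let ?seg = "\<lambda>s. p + of_real s * d"
  have cseg: "continuous_on A ?seg" for A by (intro continuous_intros)
  have gJ: "?g ` A \<subseteq> ?J" if "A \<subseteq> ?J" for A using that by (auto simp: julia_iter_iff)
  obtain L where L: "compact L" "connected L" "L \<subseteq> ?J" "?J \<inter> cball 0 (max (norm x) (norm y)) \<subseteq> L"
    by (rule julia_continuum [OF LC])
  have xyL: "x \<in> L" "y \<in> L" using L(4) xy by auto

  obtain \<sigma> where \<sigma>: "path \<sigma>" "path_image \<sigma> \<subseteq> W" "pathstart \<sigma> = hx \<epsilon>" "pathfinish \<sigma> = hy \<epsilon>"
  proof -
    have "hx \<epsilon> \<in> W" "hy \<epsilon> \<in> W" using hx(4) hy(4) \<epsilon> by auto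
    then show thesis using that connected_open_path_connected [OF UW(3,4)] unfolding path_connected_def by blast
  qed
  define \<gamma> where "\<gamma> = (\<lambda>h t. h (\<epsilon> * t) :: complex)"
  have \<gamma>: "path (\<gamma> h)" "path_image (\<gamma> h) = h ` {0..\<epsilon>}" "pathstart (\<gamma> h) = h 0" "pathfinish (\<gamma> h) = h \<epsilon>"
    if "continuous_on {0..\<epsilon>} h" for h
  proof -
    have im: "(\<lambda>t. \<epsilon> * t) ` {0..1} = {0..\<epsilon>}" using \<epsilon> by (simp add: image_mult_atLeastAtMost)
    show "path (\<gamma> h)" unfolding path_def \<gamma>_def
      by (rule continuous_on_compose2 [OF that]) (use im in \<open>auto intro!: continuous_intros\<close>)
    show "path_image (\<gamma> h) = h ` {0..\<epsilon>}"
      unfolding path_image_def \<gamma>_def im [symmetric] by (simp add: image_image)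
  qed (auto simp: \<gamma>_def pathstart_def pathfinish_def)
  define \<tau> where "\<tau> = \<gamma> hx +++ \<sigma> +++ reversepath (\<gamma> hy)"
  have \<tau>: "path \<tau>" "pathstart \<tau> = x" "pathfinish \<tau> = y"
      "path_image \<tau> = hx ` {0..\<epsilon>} \<union> path_image \<sigma> \<union> hy ` {0..\<epsilon>}"
    using \<gamma> [OF hx(1)] \<gamma> [OF hy(1)] \<sigma> hx(2) hy(2)
    by (auto simp: \<tau>_def path_image_join)
  obtain \<beta> where \<beta>: "arc \<beta>" "path_image \<beta> \<subseteq> path_image \<tau>" "pathstart \<beta> = x" "pathfinish \<beta> = y"
    using path_contains_arc [OF \<tau>(1-3) xy(1)] by blast
  have hW: "h ` {0..\<epsilon>} \<subseteq> insert (h 0) W" if "\<And>s. s \<in> {0<..\<epsilon>} \<Longrightarrow> h s \<in> W" for h :: "real \<Rightarrow> complex"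
  proof
    fix z assume "z \<in> h ` {0..\<epsilon>}"
    then obtain s where "s \<in> {0..\<epsilon>}" "z = h s" by blast
    then show "z \<in> insert (h 0) W" using that [of s] by (cases "s = 0") auto
  qed
  have \<beta>W: "path_image \<beta> \<subseteq> {x,y} \<union> W"
    using \<beta>(2) \<sigma>(2) hW [of hx, OF hx(4)] hW [of hy, OF hy(4)] hx(2) hy(2) unfolding \<tau>(4) by blast

  define A0 where "A0 = ?g ` path_image \<sigma>"
  have A0: "compact A0" "A0 \<subseteq> U"
    using \<sigma> W(2) by (auto simp: A0_def intro!: compact_continuous_image cont_iter compact_path_image)
  have g\<beta>: "?g ` path_image \<beta> \<subseteq> A0 \<union> ?seg ` {0..\<epsilon>}"
  proof
    fix w assume "w \<in> ?g ` path_image \<beta>"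
    then obtain b where b: "b \<in> path_image \<tau>" "w = ?g b" using \<beta>(2) by blast
    then consider s where "s \<in> {0..\<epsilon>}" "b = hx s" | "b \<in> path_image \<sigma>" | s where "s \<in> {0..\<epsilon>}" "b = hy s"
      unfolding \<tau>(4) by blast
    then show "w \<in> A0 \<union> ?seg ` {0..\<epsilon>}"
      by cases (use b(2) hx(3) hy(3) in \<open>auto simp: A0_def\<close>)
  qed
  have "p \<notin> A0" using A0(2) pJ UW(5) by blast
  then have "open (- A0)" "p \<in> - A0" using A0(1) by (auto simp: compact_imp_closed open_Compl)
  then obtain \<delta> where \<delta>: "\<delta> > 0" "ball p \<delta> \<subseteq> - A0" using openE by blast
  \<comment> \<open>The segment is divided so close to \<open>p\<close> that its initial part
    \<open>B\<close> misses \<open>A0\<close>. Then \<open>A\<close> and \<open>B\<close> share a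
    single point, which gives the connected intersection that Janiszewski's theorem
    requires.\<close>
  define s1 where "s1 = min \<epsilon> (\<delta> / (2 * norm d))"
  have s1: "0 < s1" "s1 \<le> \<epsilon>" "s1 * norm d < \<delta>"
  proof -
    have "s1 * norm d \<le> \<delta> / (2 * norm d) * norm d" unfolding s1_def using d by (intro mult_right_mono) auto
    also have "\<dots> < \<delta>" using \<delta> d by simp
    finally show "s1 * norm d < \<delta>" .
  qed (use \<epsilon> \<delta> d in \<open>auto simp: s1_def\<close>)
  define B where "B = ?seg ` {0..s1}"
  define A where "A = A0 \<union> ?seg ` {s1..\<epsilon>}"
  have B_segment: "B = closed_segment p (?seg s1)"
  proof -
    have "B = (\<lambda>u. (1 - u) *\<^sub>R p + u *\<^sub>R ?seg s1) ` {0..1}"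
    proof -
      have "{0..s1} = (\<lambda>u. s1 * u) ` {0..1}" using s1 by (simp add: image_mult_atLeastAtMost)
      then show ?thesis unfolding B_def
        by (simp add: image_image scaleR_conv_of_real algebra_simps)
    qed
    then show ?thesis by (auto simp: closed_segment_def image_iff)
  qed
  have AU: "A \<subseteq> U" using A0(2) ray s1 by (auto simp: A_def)
  have cA: "compact A" unfolding A_def using A0(1)
    by (intro compact_Un compact_continuous_image cseg) auto
  have BU: "B - {p} \<subseteq> U"
  proof
    fix b assume "b \<in> B - {p}"
    then obtain s where "s \<in> {0..s1}" "b = ?seg s" "s \<noteq> 0" by (auto simp: B_def)
    then show "b \<in> U" using ray [of s] s1 by auto
  qed
  have pB: "p \<in> B" using s1 by (force simp: B_def)
  have AB: "A \<inter> B = {?seg s1}"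
  proof
    show "{?seg s1} \<subseteq> A \<inter> B" using s1 by (auto simp: A_def B_def)
    show "A \<inter> B \<subseteq> {?seg s1}"
    proof
      fix z assume z: "z \<in> A \<inter> B"
      then obtain s where s: "s \<in> {0..s1}" "z = ?seg s" by (auto simp: B_def)
      have "dist p z = s * norm d" using s by (simp add: dist_norm norm_mult)
      also have "\<dots> \<le> s1 * norm d" using s by (intro mult_right_mono) auto
      finally have "z \<in> ball p \<delta>" using s1 by simp
      then have "z \<notin> A0" using \<delta> by blast
      then obtain t where "t \<in> {s1..\<epsilon>}" "z = ?seg t" using z by (auto simp: A_def)
      then have "s = t" using s(2) d by simp
      then show "z \<in> {?seg s1}" using s \<open>t \<in> {s1..\<epsilon>}\<close> by auto
    qed
  qed
  have gAB: "?g ` path_image \<beta> \<subseteq> A \<union> B"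
  proof -
    have "{0..\<epsilon>} \<subseteq> {0..s1} \<union> {s1..\<epsilon>}" using s1 by auto
    then have "?seg ` {0..\<epsilon>} \<subseteq> ?seg ` {0..s1} \<union> ?seg ` {s1..\<epsilon>}" by blast
    then show ?thesis using g\<beta> unfolding A_def B_def by blast
  qed

  \<comment> \<open>With the holes of \<open>L\<close> filled, the complement is connected; the
    unbounded \<open>W\<close> stays outside, so the cross-cut meets \<open>M\<close> only in
    \<open>x\<close> and \<open>y\<close>.\<close>
  define M where "M = L \<union> inside L"
  have clL: "closed L" "bounded L" using L(1) by (simp_all add: compact_imp_closed compact_imp_bounded)
  have M: "compact M" "connected M" "- M = outside L"
  proof -
    show eq: "- M = outside L" by (simp add: M_def outside_inside)
    then have "closed M" using open_outside [OF clL(1)] by (simp add: closed_def)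
    then show "compact M" using clL by (simp add: M_def compact_eq_bounded_closed bounded_inside)
    show "connected M" unfolding M_def using connected_with_inside [OF clL(1) L(2)] .
  qed
  have Wout: "W \<subseteq> outside L"
    by (rule inside_disjoint_unbounded [OF UW(4) Wub _ clL(2)]) (use UW(6) L(3) in blast)
  have conn_out: "connected (outside L)" "\<not> bounded (outside L)"
    using connected_outside [OF clL(2)] unbounded_outside [OF clL(2)] by auto
  have M\<beta>: "M \<inter> path_image \<beta> = {x,y}"
  proof
    have "W \<inter> M = {}" using Wout M(3) by blast
    then show "M \<inter> path_image \<beta> \<subseteq> {x,y}" using \<beta>W by blast
    show "{x,y} \<subseteq> M \<inter> path_image \<beta>"
      using \<beta>(3,4) xyL pathstart_in_path_image [of \<beta>] pathfinish_in_path_image [of \<beta>] by (auto simp: M_def)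
  qed
  let ?S = "M \<union> path_image \<beta>"
  have cS: "compact ?S" using M(1) \<beta>(1) by (simp add: compact_Un compact_arc_image)
  define Q where "Q = inside ?S"
  \<comment> \<open>If \<open>M\<close> and the cross-cut together did not separate the plane, their
    intersection \<open>{x,y}\<close> would be connected.\<close>
  have "Q \<noteq> {}"
  proof
    assume "Q = {}"
    then have "- ?S = outside ?S" by (auto simp: Q_def outside_inside)
    then have "connected (- ?S)" using connected_outside [OF compact_imp_bounded [OF cS]] by simp
    then have "connected (M \<inter> path_image \<beta>)"
      using Janiszewski_dual [OF M(1) _ M(2)] \<beta>(1) by (simp add: compact_arc_image connected_arc_image)
    then have "connected {x,y}" by (simp add: M\<beta>)
    then show False using connected_finite_iff_sing [of "{x,y}"] xy(1) by auto
  qed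
  have Q: "open Q" "bounded Q" "frontier Q \<subseteq> ?S" "Q \<inter> ?S = {}"
    unfolding Q_def
    by (intro open_inside bounded_inside frontier_inside_subset inside_no_overlap compact_imp_closed
        compact_imp_bounded cS)+
  have Qout: "Q \<subseteq> outside L" using Q(4) M(3) by blast
  have "closure Q \<inter> inside L = {}" by (rule closure_outside_disjoint_inside [OF clL(1) Qout])
  then have frQ: "frontier Q \<subseteq> L \<union> path_image \<beta>"
    using Q(3) by (auto simp: M_def frontier_def)
  \<comment> \<open>Otherwise \<open>frontier Q\<close> would lie in \<open>L\<close>, although the
    connected outside of \<open>L\<close> contains both \<open>Q\<close> and points off
    \<open>Q\<close>.\<close>
  have "Q \<inter> W \<noteq> {}"
  proof
    assume QW: "Q \<inter> W = {}"
    then have "closure Q \<inter> W = {}" using UW(3) open_Int_closure_eq_empty by (metis Int_commute)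
    then have "frontier Q \<subseteq> L" using frQ \<beta>W xyL by (auto simp: frontier_def)
    moreover have "outside L \<inter> Q \<noteq> {}" "outside L - Q \<noteq> {}"
      using Qout \<open>Q \<noteq> {}\<close> Q(2) conn_out(2) bounded_subset by blast+
    then have "outside L \<inter> frontier Q \<noteq> {}" using connected_Int_frontier [OF conn_out(1)] by blast
    ultimately show False using outside_no_overlap by blast
  qed
  then obtain q0 where q0: "q0 \<in> Q \<inter> W" by blast
  \<comment> \<open>An arc does not separate the plane, so \<open>Q \<inter> W\<close> has a
    boundary point off the cross-cut. It is a Julia point, and images of nearby points of
    \<open>Q \<inter> W\<close> can be joined to the Julia set without meeting
    \<open>A\<close>.\<close>
  have "connected (- path_image \<beta>)" using connected_arc_complement [OF \<beta>(1)] by simp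
  moreover have "- path_image \<beta> \<inter> (Q \<inter> W) \<noteq> {}" using q0 Q(4) by blast
  moreover have "- path_image \<beta> - (Q \<inter> W) \<noteq> {}"
  proof
    assume "- path_image \<beta> - (Q \<inter> W) = {}"
    then have "UNIV \<subseteq> path_image \<beta> \<union> Q" by blast
    moreover have "bounded (path_image \<beta> \<union> Q)" using Q(2) \<beta>(1) by (simp add: bounded_arc_image)
    ultimately show False using not_bounded_UNIV bounded_subset by blast
  qed
  ultimately have "- path_image \<beta> \<inter> frontier (Q \<inter> W) \<noteq> {}" by (rule connected_Int_frontier)
  then obtain j where j: "j \<notin> path_image \<beta>" "j \<in> frontier (Q \<inter> W)" by blast
  have jJ: "j \<in> ?J"
    using frontier_Int_subset [of Q W] j frQ L(3) frontier_fatou_component [OF W(1)] by blast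

  have gjJ: "?g j \<in> ?J" using jJ by (simp add: julia_iter_iff)
  then have "?g j \<in> - A" using AU UW(5) by blast
  then obtain e where e: "e > 0" "ball (?g j) e \<subseteq> - A"
    using cA openE [of "- A"] by (metis compact_imp_closed open_Compl)
  have "open (?g -` ball (?g j) e)"
    using cont_iter open_vimage by blast
  then have oN: "open (?g -` ball (?g j) e \<inter> (Q \<inter> W))" using Q(1) UW(3) by auto
  have "?g -` ball (?g j) e \<inter> (Q \<inter> W) \<noteq> {}"
  proof -
    have "j \<in> closure (Q \<inter> W)" using j by (simp add: frontier_def)
    moreover have "j \<in> ?g -` ball (?g j) e" using e by simp
    ultimately show ?thesis
      using \<open>open (?g -` ball (?g j) e)\<close> open_Int_closure_eq_empty by blast
  qed
  moreover have "open (?g ` (?g -` ball (?g j) e \<inter> (Q \<inter> W)))" by (rule open_image_iter [OF oN])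
  moreover have "interior B = {}" unfolding B_segment by (rule interior_closed_segment_ge2) simp
  \<comment> \<open>A nonempty open image does not fit into a segment, so some point has its image
    off \<open>B\<close>.\<close>
  ultimately have "\<not> ?g ` (?g -` ball (?g j) e \<inter> (Q \<inter> W)) \<subseteq> B"
    using interior_maximal by (metis image_is_empty subset_empty)
  then obtain \<zeta> where \<zeta>: "\<zeta> \<in> Q" "\<zeta> \<in> W" "?g \<zeta> \<in> ball (?g j) e" "?g \<zeta> \<notin> B" by blast
  define u where "u = ?g \<zeta>"
  have u: "u \<in> U" "u \<in> ball (?g j) e" "u \<notin> A" "u \<notin> B" "u \<in> ?g ` Q"
    using \<zeta> W(2) e(2) by (auto simp: u_def)

  have cgQ: "compact (?g ` closure Q)" using Q(2) by (intro compact_continuous_image cont_iter) simp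
  have cgL: "compact (?g ` L)" using L(1) by (intro compact_continuous_image cont_iter)
  have cB: "compact B" by (simp add: B_segment)
  have "bounded (A \<union> B \<union> ?g ` closure Q)"
    using cA cB cgQ by (simp add: compact_imp_bounded)
  then obtain R where R: "A \<union> B \<union> ?g ` closure Q \<subseteq> cball 0 R"
    unfolding bounded_iff by (auto simp: subset_iff)
  obtain v where v: "v \<in> U" "v \<notin> cball 0 R" using U(2) bounded_cball bounded_subset by (metis subsetI)
  have uvA: "connected_component (- A) u v"
  proof -
    \<comment> \<open>From \<open>u\<close> into the Julia set, along it out of the disc of radius
      \<open>R\<close>, and then to \<open>v\<close>: this works because the Julia set is connected
      and unbounded.\<close>
    let ?T = "(ball (?g j) e \<union> ?J) \<union> - cball 0 R"
    have "connected (ball (?g j) e \<union> ?J)"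
    proof (rule connected_Un)
      show "ball (?g j) e \<inter> ?J \<noteq> {}" using gjJ e(1) by (metis IntI centre_in_ball empty_iff)
    qed (auto intro: connected_julia [OF LC])
    moreover have "connected (- cball 0 R :: complex set)"
      by (rule connected_complement_bounded_convex) auto
    moreover have "(ball (?g j) e \<union> ?J) \<inter> - cball 0 R \<noteq> {}"
      using unbounded_julia bounded_subset [OF bounded_cball, of ?J 0 R] by blast
    ultimately have "connected ?T" by (rule connected_Un)
    moreover have "?T \<subseteq> - A" using e(2) AU UW(5) R by blast
    ultimately show ?thesis unfolding connected_component_def using u v by (intro exI [of _ ?T]) auto
  qed
  have uvB: "connected_component (- B) u v"
  proof -
    have "connected (- B)" unfolding B_segment
      by (rule connected_complement_bounded_convex) (auto simp: compact_imp_bounded)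
    moreover have "v \<notin> B" using v(2) R by blast
    ultimately show ?thesis unfolding connected_component_def using u by (intro exI [of _ "- B"]) auto
  qed
  have uvAB: "connected_component (- (A \<union> B)) u v"
    by (rule Janiszewski [OF cA _ _ uvA uvB]) (use cB AB in \<open>auto simp: compact_imp_closed\<close>)
  have uvL: "connected_component (- ?g ` L) u v"
  proof -
    have "U \<subseteq> - ?g ` L" using gJ [OF L(3)] UW(5) by blast
    then show ?thesis unfolding connected_component_def using UW(2) u v by blast
  qed
  have "(A \<union> B) \<inter> ?g ` L = {p}"
  proof
    have "?g x \<in> ?g ` L" using xyL by blast
    then show "{p} \<subseteq> (A \<union> B) \<inter> ?g ` L" using pB xy(4) by auto
    show "(A \<union> B) \<inter> ?g ` L \<subseteq> {p}" using AU BU gJ [OF L(3)] UW(5) by blast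
  qed
  then have "connected_component (- ((A \<union> B) \<union> ?g ` L)) u v"
    by (intro Janiszewski [OF _ _ _ uvAB uvL]) (use cA cB cgL in \<open>auto simp: compact_imp_closed\<close>)
  then obtain Z where Z: "connected Z" "Z \<subseteq> - ((A \<union> B) \<union> ?g ` L)" "u \<in> Z" "v \<in> Z"
    unfolding connected_component_def by blast
  \<comment> \<open>\<open>u\<close> and \<open>v\<close> are joined off the frontier of the image
    of \<open>Q\<close>, yet only \<open>u\<close> belongs to that image.\<close>
  have "v \<notin> ?g ` Q" using v(2) R closure_subset [of Q] by blast
  then have "Z \<inter> frontier (?g ` Q) \<noteq> {}"
    using Z u(5) by (intro connected_Int_frontier) auto
  moreover have "frontier (?g ` Q) \<subseteq> ?g ` L \<union> (A \<union> B)"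
  proof
    fix w assume w: "w \<in> frontier (?g ` Q)"
    have "closure (?g ` Q) \<subseteq> ?g ` closure Q"
      using closure_subset [of Q] cgQ by (intro closure_minimal) (auto simp: compact_imp_closed)
    moreover have "w \<notin> ?g ` Q" "w \<in> closure (?g ` Q)"
      using w open_image_iter [OF Q(1)] by (auto simp: frontier_def interior_open)
    ultimately obtain c where "c \<in> closure Q" "w = ?g c" "c \<notin> Q" by blast
    then have "c \<in> frontier Q" using Q(1) by (simp add: frontier_def interior_open)
    then have "c \<in> L \<union> path_image \<beta>" using frQ by blast
    then show "w \<in> ?g ` L \<union> (A \<union> B)" using gAB \<open>w = ?g c\<close> by blast
  qed
  ultimately show False using Z(2) by blast
qed

end

section \<open>Boundedness of Fatou components and the spider's web\<close>

text \<open>\<open>G\<close> is the component of the interior of the filled set containing the disc. Its complement is connected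
  since the other components of that interior touch the closure of the outside.\<close>

lemma filled_continuum_domain:
  fixes L :: "complex set"
  assumes L: "compact L" and R: "R > 0" "ball 0 R \<subseteq> L \<union> inside L"
  obtains G where "open G" "connected G" "bounded G" "simply_connected G" "ball 0 R \<subseteq> G" "frontier G \<subseteq> L"
proof -
  define D where "D = interior (L \<union> inside L)"
  define K where "K = closure (outside L)"
  have cl: "closed L" "bounded L" using L by (simp_all add: compact_imp_closed compact_imp_bounded)
  have "L \<union> inside L = - outside L" by (auto simp: outside_inside)
  then have DK: "D = - K" by (simp add: D_def K_def interior_complement)
  have K: "connected K" "\<not> bounded K"
    unfolding K_def using connected_outside [OF cl(2)] unbounded_outside [OF cl(2)]
    by (auto intro: connected_imp_connected_closure bounded_subset [OF _ closure_subset])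
  have "open D" by (simp add: D_def)
  have bD: "bounded D"
    by (rule bounded_subset [of "L \<union> inside L"]) (auto simp: D_def cl bounded_inside interior_subset)
  have frD: "frontier D \<subseteq> L \<inter> K"
  proof -
    have "frontier D = frontier K" by (simp add: DK)
    also have "\<dots> \<subseteq> frontier (outside L)" using interior_mono [OF closure_subset [of "outside L"]] by (auto simp: K_def frontier_def)
    also have "\<dots> \<subseteq> L" by (rule frontier_outside_subset [OF cl(1)])
    finally have "frontier D \<subseteq> L" .
    moreover have "frontier D \<subseteq> K"
      unfolding DK by (simp add: K_def frontier_subset_closed)
    ultimately show ?thesis by blast
  qed
  have RD: "ball 0 R \<subseteq> D" unfolding D_def using R by (simp add: interior_maximal)
  define G where "G = connected_component_set D 0"
  have 0: "0 \<in> D" using RD R by auto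
  have G: "open G" "connected G" "G \<subseteq> D"
    unfolding G_def using \<open>open D\<close> by (auto simp: open_connected_component connected_component_subset)
  have "inside G = {}"
  proof -
    have "\<not> bounded (connected_component_set (- G) z)" if z: "z \<notin> G" for z
    proof -
      have KG: "K \<subseteq> - G" using G(3) DK by blast
      obtain T where T: "connected T" "z \<in> T" "K \<subseteq> T" "T \<subseteq> - G"
      proof (cases "z \<in> K")
        case True
        then show thesis using that [of K] K KG by blast
      next
        case False
        then have zD: "z \<in> D" by (simp add: DK)
        define H where "H = connected_component_set D z"
        have zH: "z \<in> H" unfolding H_def using zD by simp
        have bH: "bounded H" unfolding H_def
          by (rule bounded_subset [OF bD connected_component_subset])
        have "H \<inter> G = {}"
          using z connected_component_nonoverlap [of D z 0] zD connected_component_eq [of 0 D z]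
          unfolding H_def G_def by (metis connected_component_refl_eq mem_Collect_eq connected_component_sym zD connected_component_disjoint)
        then have clH: "closure H \<inter> G = {}"
          using G(1) open_Int_closure_eq_empty [of G H] by (simp add: Int_commute)
        have "frontier H \<noteq> {}"
          using zH bH not_bounded_UNIV by (auto simp: frontier_eq_empty)
        moreover have "frontier H \<subseteq> K"
          using frontier_of_connected_component_subset [of D z] frD unfolding H_def by blast
        moreover have "frontier H \<subseteq> closure H" by (simp add: frontier_def)
        ultimately have "closure H \<inter> K \<noteq> {}" by blast
        then have "connected (closure H \<union> K)"
          using K(1) by (intro connected_Un connected_imp_connected_closure) (auto simp: H_def)
        then show thesis
          using that [of "closure H \<union> K"] zH closure_subset [of H] clH KG by blast
      qed
      have "T \<subseteq> connected_component_set (- G) z" by (rule connected_component_maximal [OF T(2,1,4)])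
      then show ?thesis using K(2) T(3) bounded_subset by blast
    qed
    then show ?thesis by (auto simp: inside_def)
  qed
  then have "simply_connected G"
    using simply_connected_eq_empty_inside [OF G(1)] G(2) by blast
  moreover have "frontier G \<subseteq> L"
    using frontier_of_connected_component_subset [of D 0] frD unfolding G_def by blast
  moreover have "ball 0 R \<subseteq> G"
    unfolding G_def using RD R by (intro connected_component_maximal) auto
  moreover have "bounded G" using bD G(3) bounded_subset by blast
  ultimately show thesis using that G by blast
qed

context transcendental_map
begin

text \<open>Otherwise the connected punctured plane would lie in \<open>U\<close>, leaving at most
  one Julia point.\<close>

lemma fatou_component_frontier_nontrivial:
  assumes U: "U \<in> components (fatou_set f)"
  obtains z where "z \<in> frontier U" "z \<noteq> a"
proof -
  have "\<not> frontier U \<subseteq> {a}"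
  proof
    assume fr: "frontier U \<subseteq> {a}"
    have oU: "open U" "U \<noteq> {}" "U \<subseteq> fatou_set f"
      using U open_components [OF open_fatou] in_components_nonempty in_components_subset by blast+
    have "\<not> U \<subseteq> {a}" using oU(1,2) by (metis not_open_singleton subset_singletonD)
    then have ne: "- {a} \<inter> U \<noteq> {}" by blast
    have "connected (- {a})" using connected_punctured_universe [of a] by simp
    then have "- {a} - U = {}"
      using connected_Int_frontier [of "- {a}" U] ne fr by blast
    then have "julia_set f \<subseteq> {a}" using oU(3) by (auto simp: julia_set_def)
    then show False using julia_not_singleton by blast
  qed
  then show thesis using that by blast
qed

text \<open>The Julia point \<open>p\<close> nearest to a point \<open>w\<close> of \<open>U\<close>
  is accessible along the radius from \<open>w\<close>. Choosing \<open>w\<close> closer than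
  \<open>dist z a / 2\<close> to a boundary point \<open>z\<close> keeps \<open>p\<close> away from
  \<open>a\<close>, which will be the exceptional value.\<close>

lemma accessible_frontier_point:
  assumes U: "U \<in> components (fatou_set f)"
  obtains p d where "p \<in> julia_set f" "p \<noteq> a" "d \<noteq> 0" "\<forall>s\<in>{0<..1}. p + of_real s * d \<in> U"
proof -
  obtain z where z: "z \<in> frontier U" "z \<noteq> a" using fatou_component_frontier_nontrivial [OF U] .
  have zJ: "z \<in> julia_set f" using frontier_fatou_component [OF U] z by blast
  have "z \<in> closure U" using z by (simp add: frontier_def)
  then obtain w where w: "w \<in> U" "dist w z < dist z a / 2"
    using z(2) unfolding closure_approachable by (metis half_gt_zero zero_less_dist_iff)
  obtain p where p: "p \<in> julia_set f" "\<And>y. y \<in> julia_set f \<Longrightarrow> dist w p \<le> dist w y"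
    using distance_attains_inf [OF closed_julia, of w] zJ by blast
  have wF: "w \<in> fatou_set f" using w in_components_subset [OF U] by blast
  have "ball w (dist w p) \<subseteq> U"
  proof (cases "w = p")
    case False
    show ?thesis
    proof (rule components_maximal [OF U])
      show "ball w (dist w p) \<subseteq> fatou_set f" using p(2) by (force simp: julia_set_def)
      have "w \<in> ball w (dist w p)" using False by simp
      then show "U \<inter> ball w (dist w p) \<noteq> {}" using w by blast
    qed simp
  qed auto
  moreover have "w \<noteq> p" using p(1) wF by (auto simp: julia_set_def)
  ultimately have seg: "p + of_real s * (w - p) \<in> U" if "s \<in> {0<..1}" for s
  proof -
    have "dist w (p + of_real s * (w - p)) = norm (of_real (1 - s) * (w - p))"
      by (simp add: dist_norm algebra_simps)
    also have "\<dots> = (1 - s) * dist w p" using that by (simp add: norm_mult dist_norm del: of_real_diff)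
    also have "\<dots> < dist w p" using that \<open>w \<noteq> p\<close> by simp
    finally show ?thesis using \<open>ball w (dist w p) \<subseteq> U\<close> by auto
  qed
  have "dist z p \<le> dist w z + dist w p" by (metis dist_commute dist_triangle)
  also have "\<dots> \<le> 2 * dist w z" using p(2) [OF zJ] by simp
  also have "\<dots> < dist z a" using w(2) by simp
  finally have "p \<noteq> a" by auto
  then show thesis using that [of p "w - p"] p(1) seg \<open>w \<noteq> p\<close> by simp
qed

theorem fatou_component_bounded:
  assumes LC: "locally connected (julia_set f)" and U: "U \<in> components (fatou_set f)"
  shows "bounded U"
proof (rule ccontr)
  assume unb: "\<not> bounded U"
  let ?J = "julia_set f"
  obtain a where a: "\<And>w. w \<noteq> a \<Longrightarrow> infinite {z. f z = w}"
    using transcendental_Picard [OF transcendental] by blast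
  obtain p d where p: "p \<in> ?J" "p \<noteq> a" "d \<noteq> 0" and ray: "\<forall>s\<in>{0<..1}. p + of_real s * d \<in> U"
    using accessible_frontier_point [OF U, of a] by blast
  obtain z where z: "z \<in> ?J" using p by blast
  let ?V = "ball z 1"
  have VJ: "?V \<inter> ?J \<noteq> {}" using z by (metis IntI centre_in_ball empty_iff zero_less_one)
  define R where "R = norm z + 1"
  define \<U> where "\<U> = {W \<in> components (- ?J). W \<inter> cball 0 R \<noteq> {} \<and> \<not> W \<subseteq> ball 0 (R + 1)}"
  have fin\<U>: "finite \<U>"
    unfolding \<U>_def by (rule finitely_many_crossing_components [OF closed_julia LC])
  \<comment> \<open>Two pull-backs are composed: the points of \<open>X\<close> differ from the
    exceptional value, so one common iterate brings them all into the disc, and \<open>f\<close>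
    maps them all to \<open>p\<close>. There is one more of them than there are crossing
    components.\<close>
  have "infinite ({x. f x = p} - {a})" using a [OF p(2)] by simp
  then obtain X where X: "finite X" "card X = Suc (card \<U>)" "X \<subseteq> {x. f x = p} - {a}"
    using infinite_arbitrarily_large by metis
  have "\<forall>\<^sub>F n in sequentially. \<forall>x\<in>X. x \<in> (f ^^ n) ` ?V"
    using X strong_blow_up [OF open_ball VJ a] by (intro eventually_ball_finite) auto
  then obtain n where n: "\<And>x. x \<in> X \<Longrightarrow> x \<in> (f ^^ n) ` ?V"
    by (auto simp: eventually_sequentially)
  then have "\<forall>x\<in>X. \<exists>v. v \<in> ?V \<and> (f ^^ n) v = x" by blast
  then obtain v where v: "\<And>x. x \<in> X \<Longrightarrow> v x \<in> ?V \<and> (f ^^ n) (v x) = x" by metis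
  let ?g = "f ^^ Suc n"
  have gv: "?g (v x) = p" if "x \<in> X" for x using v [OF that] X(3) that by auto
  \<comment> \<open>Accessibility of \<open>v x\<close> from \<open>W\<close> along a lift of the
    segment; the bound 1 keeps \<open>s\<close> where the segment is known to lie in
    \<open>U\<close>.\<close>
  define acc where "acc = (\<lambda>x W. \<exists>\<epsilon> h. \<epsilon> > 0 \<and> \<epsilon> \<le> 1 \<and> continuous_on {0..\<epsilon>} h \<and> h 0 = v x \<and>
      (\<forall>s\<in>{0..\<epsilon>}. ?g (h s) = p + of_real s * d) \<and> (\<forall>s\<in>{0<..\<epsilon>}. h s \<in> W))"
  have "\<exists>W. W \<in> \<U> \<and> ?g ` W \<subseteq> U \<and> acc x W" if x: "x \<in> X" for x
  proof -
    obtain \<epsilon>0 h where h: "\<epsilon>0 > 0" "continuous_on {0..\<epsilon>0} h" "h 0 = v x"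
        "\<And>s. s \<in> {0..\<epsilon>0} \<Longrightarrow> ?g (h s) = p + of_real s * d"
      using lift_ray [OF holo_iter iterate_nonconstant gv [OF x]] by metis
    define \<epsilon> where "\<epsilon> = min \<epsilon>0 1"
    have \<epsilon>: "\<epsilon> > 0" "\<epsilon> \<le> 1" "\<epsilon> \<le> \<epsilon>0" using h by (auto simp: \<epsilon>_def)
    have c: "continuous_on {0..\<epsilon>} h" by (rule continuous_on_subset [OF h(2)]) (use \<epsilon> in auto)
    have ghU: "?g (h s) \<in> U" if "s \<in> {0<..\<epsilon>}" for s
      using h(4) [of s] ray that \<epsilon> by auto
    have hF: "h ` {0<..\<epsilon>} \<subseteq> fatou_set f"
    proof
      fix y assume "y \<in> h ` {0<..\<epsilon>}"
      then have "?g y \<in> fatou_set f" using ghU in_components_subset [OF U] by blast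
      then show "y \<in> fatou_set f" using fatou_iter_iff by blast
    qed
    have ch: "connected (h ` {0<..\<epsilon>})"
      by (intro connected_continuous_image continuous_on_subset [OF c]) auto
    have "h \<epsilon> \<in> h ` {0<..\<epsilon>}" using \<epsilon> by auto
    then have "fatou_set f \<noteq> {}" using hF by blast
    then obtain W where W: "W \<in> components (fatou_set f)" "h ` {0<..\<epsilon>} \<subseteq> W"
      using exists_component_superset [OF hF _ ch] by metis
    have gW: "?g ` W \<subseteq> U"
    proof (rule fatou_component_image_subset [OF U W(1)])
      have "h \<epsilon> \<in> W" "?g (h \<epsilon>) \<in> U" using W(2) ghU [of \<epsilon>] \<epsilon> by auto
      then show "?g ` W \<inter> U \<noteq> {}" by blast
    qed
    \<comment> \<open>Unbounded and, by accessibility of \<open>v x\<close>, meeting the disc: so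
      \<open>W\<close> is one of the finitely many crossing components.\<close>
    have Wunb: "\<not> bounded W" by (rule unbounded_fatou_preimage [OF U unb W(1) gW])
    have "closure {0<..\<epsilon>} = {0..\<epsilon>}" using \<epsilon> by (simp add: closure_greaterThanAtMost)
    then have "h ` {0..\<epsilon>} \<subseteq> closure W"
      using image_closure_subset [of "{0<..\<epsilon>}" h "closure W"] c W(2) closure_subset [of W] by auto
    then have "v x \<in> closure W" using h(3) \<epsilon> by force
    then have "?V \<inter> W \<noteq> {}" using v [OF x] open_Int_closure_eq_empty [OF open_ball] by blast
    moreover have "?V \<subseteq> cball 0 R"
    proof
      fix y assume "y \<in> ?V"
      then show "y \<in> cball 0 R"
        using norm_triangle_ineq2 [of y z] by (simp add: R_def dist_norm norm_minus_commute)
    qed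
    moreover have "\<not> W \<subseteq> ball 0 (R + 1)" using Wunb bounded_ball bounded_subset by blast
    ultimately have "W \<in> \<U>" using W(1) by (auto simp: \<U>_def julia_Compl)
    moreover have "acc x W"
      unfolding acc_def using \<epsilon> c h(3,4) W(2) by (intro exI [of _ \<epsilon>] exI [of _ h]) auto
    ultimately show ?thesis using gW by blast
  qed
  then obtain W where W: "\<And>x. x \<in> X \<Longrightarrow> W x \<in> \<U> \<and> ?g ` W x \<subseteq> U \<and> acc x (W x)" by metis
  have "\<not> inj_on W X"
  proof
    assume "inj_on W X"
    then have "card X \<le> card \<U>" using W fin\<U> by (intro card_inj_on_le) auto
    then show False using X(2) by simp
  qed
  then obtain x y where xy: "x \<in> X" "y \<in> X" "x \<noteq> y" "W x = W y" by (auto simp: inj_on_def)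
  obtain \<epsilon>x hx where hx: "\<epsilon>x > 0" "\<epsilon>x \<le> 1" "continuous_on {0..\<epsilon>x} hx" "hx 0 = v x"
      "\<forall>s\<in>{0..\<epsilon>x}. ?g (hx s) = p + of_real s * d" "\<forall>s\<in>{0<..\<epsilon>x}. hx s \<in> W x"
    using W [OF xy(1)] unfolding acc_def by blast
  obtain \<epsilon>y hy where hy: "\<epsilon>y > 0" "\<epsilon>y \<le> 1" "continuous_on {0..\<epsilon>y} hy" "hy 0 = v y"
      "\<forall>s\<in>{0..\<epsilon>y}. ?g (hy s) = p + of_real s * d" "\<forall>s\<in>{0<..\<epsilon>y}. hy s \<in> W y"
    using W [OF xy(2)] unfolding acc_def by blast
  define \<epsilon> where "\<epsilon> = min \<epsilon>x \<epsilon>y"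
  have vJ: "v u \<in> ?J" if "u \<in> X" for u using gv [OF that] p(1) julia_iter_iff by metis
  show False
  proof (rule two_accesses_contradiction [OF LC U unb, of "W x" "Suc n" "v x" "v y" p d \<epsilon> hx hy])
    show "W x \<in> components (fatou_set f)" using W [OF xy(1)] by (simp add: \<U>_def julia_Compl)
    show "?g ` W x \<subseteq> U" using W [OF xy(1)] by blast
    show "v x \<noteq> v y" using v xy by metis
    show "v x \<in> ?J" "v y \<in> ?J" using vJ xy by auto
    show "?g (v x) = p" "?g (v y) = p" using gv xy by auto
    show "continuous_on {0..\<epsilon>} hx" by (rule continuous_on_subset [OF hx(3)]) (simp add: \<epsilon>_def)
    show "continuous_on {0..\<epsilon>} hy" by (rule continuous_on_subset [OF hy(3)]) (simp add: \<epsilon>_def)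
    show "p + of_real s * d \<in> U" if "s \<in> {0<..\<epsilon>}" for s
      using ray that hx(2) by (simp add: \<epsilon>_def)
    show "hx s \<in> W x" "hy s \<in> W x" if "s \<in> {0<..\<epsilon>}" for s
      using hx(6) hy(6) that xy(4) by (auto simp: \<epsilon>_def)
    show "?g (hx s) = p + of_real s * d" "?g (hy s) = p + of_real s * d" if "s \<in> {0..\<epsilon>}" for s
      using hx(5) hy(5) that by (auto simp: \<epsilon>_def simp del: funpow.simps)
  qed (use p hx hy in \<open>auto simp: \<epsilon>_def\<close>)
qed

lemma julia_encloses_ball:
  assumes LC: "locally connected (julia_set f)" and R: "R > 0"
  obtains G where "open G" "connected G" "bounded G" "simply_connected G" "ball 0 R \<subseteq> G"
    "frontier G \<subseteq> julia_set f"
proof -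
  let ?J = "julia_set f"
  define \<U> where "\<U> = {W \<in> components (- ?J). W \<inter> cball 0 R \<noteq> {} \<and> \<not> W \<subseteq> ball 0 (R + 1)}"
  have "finite \<U>"
    unfolding \<U>_def by (rule finitely_many_crossing_components [OF closed_julia LC])
  moreover have "bounded W" if "W \<in> \<U>" for W
    using fatou_component_bounded [OF LC] that by (simp add: \<U>_def julia_Compl)
  ultimately have "bounded (\<Union>\<U> \<union> ball 0 (R + 1))" by (simp add: bounded_Union)
  \<comment> \<open>The disc of radius \<open>R'\<close> contains every Fatou component that meets
    the ball: the finitely many crossing ones are bounded, the others stay within radius
    \<open>R + 1\<close>.\<close>
  then obtain R' where R': "\<And>z. z \<in> \<Union>\<U> \<union> ball 0 (R + 1) \<Longrightarrow> norm z \<le> R'"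
    unfolding bounded_iff by blast
  obtain L where L: "compact L" "connected L" "L \<subseteq> ?J" "?J \<inter> cball 0 R' \<subseteq> L"
    by (rule julia_continuum [OF LC])
  have "z \<in> L \<union> inside L" if z: "z \<in> ball 0 R" for z
  proof (cases "z \<in> ?J")
    case True
    have "norm z \<le> R'" using R' [of z] z by auto
    then show ?thesis using True L(4) by auto
  next
    case False
    then have "z \<in> \<Union> (components (- ?J))" by simp
    then obtain U where U: "U \<in> components (- ?J)" "z \<in> U" by blast
    have "U \<subseteq> cball 0 R'"
    proof (cases "U \<in> \<U>")
      case True
      then have "U \<subseteq> \<Union>\<U> \<union> ball 0 (R + 1)" by blast
      then show ?thesis using R' by (meson mem_cball_0 subsetD subsetI)
    next
      case False
      have "z \<in> U \<inter> cball 0 R" using z U by auto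
      then have "U \<subseteq> ball 0 (R + 1)" using False U by (auto simp: \<U>_def)
      then have "U \<subseteq> \<Union>\<U> \<union> ball 0 (R + 1)" by blast
      then show ?thesis using R' by (meson mem_cball_0 subsetD subsetI)
    qed
    then have "closure U \<subseteq> cball 0 R'" by (rule closure_minimal) simp
    moreover have "frontier U \<subseteq> ?J" using frontier_fatou_component U by (simp add: julia_Compl)
    ultimately have frU: "frontier U \<subseteq> L" using L(4) by (auto simp: frontier_def)
    \<comment> \<open>The frontier of \<open>U\<close> is part of \<open>L\<close>, so a connected
      set that avoids \<open>L\<close> and starts in \<open>U\<close> cannot leave it.\<close>
    have "connected_component_set (- L) z \<subseteq> U"
    proof (rule ccontr)
      assume "\<not> ?thesis"
      moreover have zL: "z \<in> - L" using False L(3) by blast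
      ultimately have "connected_component_set (- L) z \<inter> frontier U \<noteq> {}"
      proof (intro connected_Int_frontier)
        have "z \<in> connected_component_set (- L) z" using zL by simp
        then show "connected_component_set (- L) z \<inter> U \<noteq> {}" using U(2) by blast
      qed auto
      then show False using frU connected_component_subset [of "- L" z] by blast
    qed
    then have "bounded (connected_component_set (- L) z)"
      using \<open>U \<subseteq> cball 0 R'\<close> bounded_cball bounded_subset by (metis subset_trans)
    moreover have "z \<notin> L" using False L(3) by blast
    ultimately show ?thesis by (simp add: inside_def)
  qed
  then have sub: "ball 0 R \<subseteq> L \<union> inside L" by blast
  show thesis
    by (rule filled_continuum_domain [OF L(1) R sub]) (use that L(3) in blast)
qed

theorem spiders_web_julia:
  assumes LC: "locally connected (julia_set f)"
  shows "spiders_web (julia_set f)"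
proof -
  define good where "good = (\<lambda>G. open G \<and> connected G \<and> bounded G \<and> simply_connected G \<and> frontier G \<subseteq> julia_set f)"
  have ex: "\<exists>G. good G \<and> ball 0 R \<subseteq> G" if "R > 0" for R
    using julia_encloses_ball [OF LC that] unfolding good_def by metis
  have "\<exists>G. \<forall>k. (good (G k) \<and> ball 0 (real (Suc k)) \<subseteq> G k) \<and> G k \<subseteq> G (Suc k)"
  proof (rule dependent_nat_choice)
    show "\<exists>G. good G \<and> ball 0 (real (Suc 0)) \<subseteq> G" by (rule ex) simp
    fix G k assume G: "good G \<and> ball 0 (real (Suc k)) \<subseteq> G"
    then obtain r where r: "\<And>z. z \<in> G \<Longrightarrow> norm z \<le> r"
      unfolding good_def bounded_iff by blast
    have "max (r + 1) (real (Suc (Suc k))) > 0" by (simp add: less_max_iff_disj)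
    \<comment> \<open>The first radius makes \<open>G'\<close> swallow \<open>G\<close>, the second
      makes the sequence exhaust the plane.\<close>
    then obtain G' where G': "good G'" "ball 0 (max (r + 1) (real (Suc (Suc k)))) \<subseteq> G'"
      using ex by blast
    have "G \<subseteq> ball 0 (max (r + 1) (real (Suc (Suc k))))" using r by fastforce
    moreover have "ball 0 (real (Suc (Suc k))) \<subseteq> ball (0::complex) (max (r + 1) (real (Suc (Suc k))))"
      by (rule subset_ball) simp
    ultimately show "\<exists>G'. (good G' \<and> ball 0 (real (Suc (Suc k))) \<subseteq> G') \<and> G \<subseteq> G'"
      using G' by (intro exI [of _ G']) blast
  qed
  then obtain G where G: "\<And>k. good (G k)" "\<And>k. ball 0 (real (Suc k)) \<subseteq> G k" "\<And>k. G k \<subseteq> G (Suc k)"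
    by blast
  have "G k \<noteq> {}" for k
    using G(2) [of k] by auto
  moreover have "(\<Union>k. G k) = UNIV"
  proof -
    have "z \<in> (\<Union>k. G k)" for z
    proof -
      obtain k where "norm z < real k" using reals_Archimedean2 by blast
      then have "z \<in> ball 0 (real (Suc k))" by simp
      then show ?thesis using G(2) by blast
    qed
    then show ?thesis by blast
  qed
  ultimately show ?thesis
    unfolding spiders_web_def
    using connected_julia [OF LC] G by (intro conjI exI [of _ G]) (auto simp: good_def)
qed

end

theorem theorem1p1:
  fixes f :: "complex \<Rightarrow> complex"
  assumes "transcendental_entire f"
    and "locally connected (julia_set f)"
  shows "spiders_web (julia_set f)"
proof -
  interpret transcendental_map f using assms(1) by unfold_locales
  show ?thesis using assms(2) by (rule spiders_web_julia)
qed

end
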